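(* Let $T$ and $P$ be p-strings with $n=|T|$, $m=|P|$, and assume $\Pi_P\neq\emptyset$. There is an algorithm that, given $T$ and $P$, outputs all positions $0\le i\le n-m$ such that $T[i:i+m]\equiv P$, running in $O(|\Pi_P|\,n+m)$ time and using $O(\log m+|\Pi|)$ space in addition to the input.
   Context: Let $\Sigma$ (constant alphabet) and $\Pi$ (parameter alphabet) be disjoint finite alphabets. A p-string is a string over $\Sigma\cup\Pi$. For a p-string $w$, $w[i]$ is its $i$-th letter (0-based), and for $0\le i\le j\le|w|$, $w[i:j]=w[i]w[i+1]\cdots w[j-1]$. A permutation $f$ of $\Pi$ is extended by $f(c)=c$ for $c\in\Sigma$ and letterwise to p-strings. Two p-strings $x,y$ p-match, written $x\equiv y$, iff there is a permutation $f$ of $\Pi$ with $f(x)=y$. For a p-string $w$, $\Pi_w$ denotes the set of parameter characters occurring in $w$. Computing model: functions $\Pi\to\mathbb{N}$ can be stored as arrays with constant-time access. *)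

theory Defs
  imports Complex_Main "HOL-Combinatorics.Permutations"
begin

section \<open>Parameterized strings\<close>

text \<open>The constant alphabet is a set \<open>Sig\<close> and the parameter alphabet a set \<open>Par\<close>; p-strings are
  the elements of \<open>lists (Sig \<union> Par)\<close>. The predicate \<open>permutes\<close> requires \<open>f\<close> to be the identity
  outside \<open>Par\<close>, which is the extension of a permutation of \<open>Par\<close> by \<open>f c = c\<close> on constants.\<close>

definition p_match :: "'a set \<Rightarrow> 'a list \<Rightarrow> 'a list \<Rightarrow> bool" where
  "p_match Par x y \<longleftrightarrow> (\<exists>f. f permutes Par \<and> map f x = y)"

definition params :: "'a set \<Rightarrow> 'a list \<Rightarrow> 'a set" where
  "params Par w = set w \<inter> Par"

definition substring :: "'a list \<Rightarrow> nat \<Rightarrow> nat \<Rightarrow> 'a list" where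
  "substring w i j = take (j - i) (drop i w)"

text \<open>The constraint \<open>i + length P \<le> length T\<close> expresses \<open>0 \<le> i \<le> n - m\<close> without truncated
  subtraction; there is no such position if \<open>m > n\<close>.\<close>

definition p_occurrences :: "'a set \<Rightarrow> 'a list \<Rightarrow> 'a list \<Rightarrow> nat set" where
  "p_occurrences Par T P =
     {i. i + length P \<le> length T \<and> p_match Par (substring T i (i + length P)) P}"

section \<open>A word RAM\<close>

text \<open>Programs are finite structured programs over three-address instructions, each of unit cost.
  A program uses finitely many word registers and a single random-access memory of words; it can
  read, but not modify, the two input strings, and can append to, but not read, the output.
  The program text does not depend on the input or on the alphabets.\<close>

datatype operand = Imm nat | Reg nat

datatype binop = Add | Sub | Mul | Div | Mod

datatype rel = Lt | Le | Eq | Neq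

datatype com =
    Skip
  | Move nat operand
  | Op nat binop operand operand
  | Load nat operand
  | Store operand operand
  | ReadT nat operand
  | ReadP nat operand
  | Emit operand
  | Seq com com
  | IF rel operand operand com com
  | WHILE rel operand operand com

record state =
  reg :: "nat \<Rightarrow> nat"
  mem :: "nat \<Rightarrow> nat"
  out :: "nat list"

fun val :: "state \<Rightarrow> operand \<Rightarrow> nat" where
  "val st (Imm v) = v"
| "val st (Reg r) = reg st r"

fun apply_op :: "binop \<Rightarrow> nat \<Rightarrow> nat \<Rightarrow> nat" where
  "apply_op Add x y = x + y"
| "apply_op Sub x y = x - y"
| "apply_op Mul x y = x * y"
| "apply_op Div x y = x div y"
| "apply_op Mod x y = x mod y"

fun holds :: "rel \<Rightarrow> nat \<Rightarrow> nat \<Rightarrow> bool" where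
  "holds Lt x y \<longleftrightarrow> x < y"
| "holds Le x y \<longleftrightarrow> x \<le> y"
| "holds Eq x y \<longleftrightarrow> x = y"
| "holds Neq x y \<longleftrightarrow> x \<noteq> y"

definition set_reg :: "nat \<Rightarrow> nat \<Rightarrow> state \<Rightarrow> state" where
  "set_reg r v st = st\<lparr>reg := (reg st)(r := v)\<rparr>"

definition set_mem :: "nat \<Rightarrow> nat \<Rightarrow> state \<Rightarrow> state" where
  "set_mem a v st = st\<lparr>mem := (mem st)(a := v)\<rparr>"

text \<open>\<open>exec T P w s c st t st'\<close>: started in \<open>st\<close> on the inputs \<open>T\<close> and \<open>P\<close>, the program \<open>c\<close>
  terminates in \<open>st'\<close> after exactly \<open>t\<close> steps, where all words are below \<open>w\<close> and all accessed
  memory addresses are below \<open>s\<close>. There is no rule for a word overflow, for a memory access beyond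
  \<open>s\<close>, or for reading past the end of an input: such a run gets stuck.\<close>

inductive exec ::
  "nat list \<Rightarrow> nat list \<Rightarrow> nat \<Rightarrow> nat \<Rightarrow> com \<Rightarrow> state \<Rightarrow> nat \<Rightarrow> state \<Rightarrow> bool"
  for T P :: "nat list" and w s :: nat
where
  Skip: "exec T P w s Skip st 1 st"
| Move: "val st a < w \<Longrightarrow>
    exec T P w s (Move r a) st 1 (set_reg r (val st a) st)"
| Op: "apply_op f (val st a) (val st b) < w \<Longrightarrow>
    exec T P w s (Op r f a b) st 1 (set_reg r (apply_op f (val st a) (val st b)) st)"
| Load: "val st a < s \<Longrightarrow> mem st (val st a) < w \<Longrightarrow>
    exec T P w s (Load r a) st 1 (set_reg r (mem st (val st a)) st)"
| Store: "val st a < s \<Longrightarrow> val st b < w \<Longrightarrow>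
    exec T P w s (Store a b) st 1 (set_mem (val st a) (val st b) st)"
| ReadT: "val st a < length T \<Longrightarrow> T ! val st a < w \<Longrightarrow>
    exec T P w s (ReadT r a) st 1 (set_reg r (T ! val st a) st)"
| ReadP: "val st a < length P \<Longrightarrow> P ! val st a < w \<Longrightarrow>
    exec T P w s (ReadP r a) st 1 (set_reg r (P ! val st a) st)"
| Emit: "val st a < w \<Longrightarrow>
    exec T P w s (Emit a) st 1 (st\<lparr>out := out st @ [val st a]\<rparr>)"
| Seq: "exec T P w s c1 st t1 st1 \<Longrightarrow> exec T P w s c2 st1 t2 st2 \<Longrightarrow>
    exec T P w s (Seq c1 c2) st (t1 + t2) st2"
| IfTrue: "holds q (val st a) (val st b) \<Longrightarrow> exec T P w s c1 st t st' \<Longrightarrow>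
    exec T P w s (IF q a b c1 c2) st (1 + t) st'"
| IfFalse: "\<not> holds q (val st a) (val st b) \<Longrightarrow> exec T P w s c2 st t st' \<Longrightarrow>
    exec T P w s (IF q a b c1 c2) st (1 + t) st'"
| WhileFalse: "\<not> holds q (val st a) (val st b) \<Longrightarrow>
    exec T P w s (WHILE q a b c) st 1 st"
| WhileTrue: "holds q (val st a) (val st b) \<Longrightarrow> exec T P w s c st t1 st1 \<Longrightarrow>
    exec T P w s (WHILE q a b c) st1 t2 st2 \<Longrightarrow>
    exec T P w s (WHILE q a b c) st (1 + t1 + t2) st2"

fun operand_regs :: "operand \<Rightarrow> nat set" where
  "operand_regs (Imm v) = {}"
| "operand_regs (Reg r) = {r}"

fun regs :: "com \<Rightarrow> nat set" where
  "regs Skip = {}"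
| "regs (Move r a) = insert r (operand_regs a)"
| "regs (Op r f a b) = insert r (operand_regs a \<union> operand_regs b)"
| "regs (Load r a) = insert r (operand_regs a)"
| "regs (Store a b) = operand_regs a \<union> operand_regs b"
| "regs (ReadT r a) = insert r (operand_regs a)"
| "regs (ReadP r a) = insert r (operand_regs a)"
| "regs (Emit a) = operand_regs a"
| "regs (Seq c1 c2) = regs c1 \<union> regs c2"
| "regs (IF q a b c1 c2) = operand_regs a \<union> operand_regs b \<union> regs c1 \<union> regs c2"
| "regs (WHILE q a b c) = operand_regs a \<union> operand_regs b \<union> regs c"

text \<open>Initially the registers 0, 1, 2 hold the lengths of the text and of the pattern and the
  size of the parameter alphabet. All other registers and the memory are zero.\<close>

definition init_state :: "nat \<Rightarrow> nat \<Rightarrow> nat \<Rightarrow> state" where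
  "init_state n m k =
     \<lparr>reg = (\<lambda>_. 0)(0 := n, 1 := m, 2 := k), mem = (\<lambda>_. 0), out = []\<rparr>"

text \<open>Letters are presented to the machine as numbers: the parameters as the numbers below
  \<open>card Par\<close>, in any order, so that functions on the parameters can be stored as arrays, and the
  constants, in any order, as the numbers that follow.\<close>

definition letter_coding :: "'a set \<Rightarrow> 'a set \<Rightarrow> ('a \<Rightarrow> nat) \<Rightarrow> bool" where
  "letter_coding Sig Par code \<longleftrightarrow>
     bij_betw code Par {..<card Par} \<and>
     bij_betw code Sig {card Par..<card Par + card Sig}"

text \<open>Running within time \<open>t\<close> and space \<open>s\<close>, on words with values below \<open>w\<close>, the program halts
  having output exactly the p-occurrences, each once. The space is the number of registers of the
  program plus the extent of the memory it accesses; input and output do not count.\<close>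

definition finds_p_occurrences ::
  "com \<Rightarrow> 'a set \<Rightarrow> ('a \<Rightarrow> nat) \<Rightarrow> 'a list \<Rightarrow> 'a list \<Rightarrow> nat \<Rightarrow> nat \<Rightarrow> nat \<Rightarrow> bool"
where
  "finds_p_occurrences prog Par code T P w t s \<longleftrightarrow>
     (\<exists>st t' s'.
        exec (map code T) (map code P) w s' prog
          (init_state (length T) (length P) (card Par)) t' st \<and>
        distinct (out st) \<and> set (out st) = p_occurrences Par T P \<and>
        t' \<le> t \<and> card (regs prog) + s' \<le> s)"

end

theory Submission
  imports Defs
begin

text \<open>The pattern \<open>P\<close> is slid along \<open>W = P T\<close>, as in the algorithm of Galil and Seiferas, from
  position 1 on; positions inside \<open>P\<close> teach the algorithm the periods of \<open>P\<close> before the text is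
  reached. With \<open>k = |\<Pi>\<^sub>P| + 4\<close>, call \<open>(q, r)\<close> a scope if \<open>q\<close> is the least p-period of \<open>P[0:r]\<close>,
  \<open>k q \<le> r\<close>, and \<open>r\<close> is the longest such length. After a maximal match of length \<open>j\<close> at position
  \<open>p\<close>, let \<open>(q, r)\<close> be the first known scope with \<open>j \<le> r\<close>. If \<open>k q \<le> j\<close>, then \<open>q\<close> is the least
  p-period of \<open>P[0:j]\<close> and shifting by \<open>q\<close> keeps \<open>j - q\<close> matched letters; otherwise the least
  p-period exceeds \<open>j / k\<close>, and one shifts by \<open>j div k + 1\<close> and restarts with an empty match.

  Two scope periods \<open>p < q\<close> satisfy \<open>2 p \<le> q\<close>: the first \<open>|\<Pi>\<^sub>P|\<close> blocks of length \<open>p\<close> already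
  contain all parameters, so for \<open>q < 2 p\<close> the permutations belonging to \<open>p\<close> and \<open>q\<close> commute on the
  pattern, and \<open>q - p\<close> would be a smaller p-period. Hence there are \<open>O(log m)\<close> scopes. The time bound
  follows from the potential \<open>2 k (n + m - p) + (m - j)\<close>, which pays \<open>k\<close> for each unit of shift and
  thus also for rebuilding the matching function in \<open>O(|\<Pi>\<^sub>P|)\<close> steps.\<close>

section \<open>Periods of parameterized strings\<close>

text \<open>The pairs \<open>x i\<close>, \<open>y i\<close> describe a partial injection of
  \<open>S\<close> into itself. As \<open>S\<close> is finite, the complements of its domain and of
  its range have equal size, so it extends to a permutation. This turns p-matching into a condition
  on pairs of positions.\<close>

lemma ex_permutes_iff:
  assumes fin: "finite S"
  shows "(\<exists>f. f permutes S \<and> (\<forall>i\<in>I. f (x i) = y i)) \<longleftrightarrow>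
    (\<forall>i\<in>I. (x i \<in> S \<longleftrightarrow> y i \<in> S) \<and> (x i \<notin> S \<longrightarrow> x i = y i) \<and>
      (\<forall>i'\<in>I. x i = x i' \<longleftrightarrow> y i = y i'))" (is "?L \<longleftrightarrow> ?R")
proof
  assume ?L
  then obtain f where f: "f permutes S" "\<And>i. i \<in> I \<Longrightarrow> f (x i) = y i" by blast
  have "(x i \<in> S \<longleftrightarrow> y i \<in> S) \<and> (x i \<notin> S \<longrightarrow> x i = y i)" if "i \<in> I" for i
    using permutes_in_image[OF f(1), of "x i"] permutes_not_in[OF f(1), of "x i"] f(2)[OF that] by auto
  moreover have "x i = x i' \<longleftrightarrow> y i = y i'" if "i \<in> I" "i' \<in> I" for i i'
    using inj_eq[OF permutes_inj[OF f(1)], of "x i" "x i'"] f(2) that by simp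
  ultimately show ?R by blast
next
  assume R: ?R
  define A where "A = x ` I \<inter> S"
  \<comment> \<open>Any index with \<open>x i = a\<close> may be chosen: by \<open>R\<close>,
    indices with equal \<open>x\<close> have equal \<open>y\<close>.\<close>
  define h where "h a = y (SOME i. i \<in> I \<and> x i = a)" for a
  have h: "h (x i) = y i" if "i \<in> I" for i
  proof -
    have "(SOME i'. i' \<in> I \<and> x i' = x i) \<in> I \<and> x (SOME i'. i' \<in> I \<and> x i' = x i) = x i"
      by (rule someI[of _ i]) (use that in simp)
    then show ?thesis unfolding h_def using R that by metis
  qed
  have R1: "x i \<in> S \<longleftrightarrow> y i \<in> S" and R2: "x i \<notin> S \<Longrightarrow> x i = y i" if "i \<in> I" for i
    using R that by blast+
  have R3: "x i = x i'" if "y i = y i'" "i \<in> I" "i' \<in> I" for i i' using R that by blast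
  have inj: "inj_on h A"
  proof (rule inj_onI)
    fix a b assume "a \<in> A" "b \<in> A" "h a = h b"
    then obtain i i' where "i \<in> I" "i' \<in> I" "a = x i" "b = x i'" by (auto simp: A_def)
    with \<open>h a = h b\<close> show "a = b" using R3[of i i'] h by simp
  qed
  have hA: "h ` A \<subseteq> S"
  proof
    fix b assume "b \<in> h ` A"
    then obtain i where "i \<in> I" "x i \<in> S" "b = h (x i)" by (auto simp: A_def)
    then show "b \<in> S" using R1 h by simp
  qed
  have AS: "A \<subseteq> S" by (simp add: A_def)
  have "card (S - A) = card (S - h ` A)"
    using fin AS hA inj by (simp add: card_Diff_subset finite_subset card_image)
  then obtain g where g: "bij_betw g (S - A) (S - h ` A)"
    using fin finite_same_card_bij[of "S - A" "S - h ` A"] by auto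
  define f where "f a = (if a \<in> A then h a else if a \<in> S then g a else a)" for a
  have "bij_betw f (A \<union> (S - A)) (h ` A \<union> (S - h ` A))"
  proof (rule bij_betw_combine)
    show "bij_betw f A (h ` A)"
      using inj by (simp add: bij_betw_def f_def inj_on_def)
    show "bij_betw f (S - A) (S - h ` A)"
      using g bij_betw_cong[of "S - A" f g] by (simp add: f_def)
  qed auto
  then have "bij_betw f S S" using AS hA by (simp add: Un_absorb1)
  then have "f permutes S"
    by (rule bij_imp_permutes) (use AS in \<open>auto simp: f_def\<close>)
  moreover have "f (x i) = y i" if "i \<in> I" for i
    using that h[OF that] R2[OF that] by (cases "x i \<in> S") (simp_all add: f_def A_def)
  ultimately show ?L by blast
qed

section \<open>P-matching of factors of one word\<close>

locale pstring =
  fixes W :: "nat \<Rightarrow> nat" and K m :: nat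
begin

text \<open>\<open>W\<close> stands for the word \<open>P T\<close>, with \<open>P\<close> as its
  first \<open>m\<close> letters and the parameters coded below \<open>K\<close>. For
  \<open>p + j \<le> m\<close>, \<open>eqv 0 p j\<close> says that \<open>p\<close> is a p-period of
  the prefix of length \<open>p + j\<close>, so one predicate serves occurrences and periods
  alike.\<close>

definition eqv :: "nat \<Rightarrow> nat \<Rightarrow> nat \<Rightarrow> bool" where
  "eqv a b l \<longleftrightarrow> (\<exists>f. f permutes {..<K} \<and> (\<forall>i<l. f (W (a + i)) = W (b + i)))"

lemma eqv_iff: "eqv a b l \<longleftrightarrow>
    (\<forall>i<l. (W (a + i) < K \<longleftrightarrow> W (b + i) < K) \<and> (\<not> W (a + i) < K \<longrightarrow> W (a + i) = W (b + i)) \<and>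
      (\<forall>i'<l. W (a + i) = W (a + i') \<longleftrightarrow> W (b + i) = W (b + i')))"
  unfolding eqv_def
  using ex_permutes_iff[of "{..<K}" "{..<l}" "\<lambda>i. W (a + i)" "\<lambda>i. W (b + i)"]
  by (simp only: Ball_def lessThan_iff finite_lessThan simp_thms)

lemma eqv_0 [simp]: "eqv a b 0"
  unfolding eqv_def using permutes_id by blast

lemma eqv_sym:
  assumes "eqv a b l"
  shows "eqv b a l"
proof -
  obtain f where f: "f permutes {..<K}" "\<And>i. i < l \<Longrightarrow> f (W (a + i)) = W (b + i)"
    using assms unfolding eqv_def by blast
  have "inv f (W (b + i)) = W (a + i)" if "i < l" for i
    using permutes_inv_eq[OF f(1)] f(2)[OF that] by simp
  then show ?thesis unfolding eqv_def using permutes_inv[OF f(1)] by blast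
qed

lemma eqv_trans:
  assumes "eqv a b l" "eqv b c l"
  shows "eqv a c l"
proof -
  obtain f where f: "f permutes {..<K}" "\<And>i. i < l \<Longrightarrow> f (W (a + i)) = W (b + i)"
    using assms(1) unfolding eqv_def by blast
  obtain g where g: "g permutes {..<K}" "\<And>i. i < l \<Longrightarrow> g (W (b + i)) = W (c + i)"
    using assms(2) unfolding eqv_def by blast
  have "(g \<circ> f) (W (a + i)) = W (c + i)" if "i < l" for i
    using f(2)[OF that] g(2)[OF that] by simp
  then show ?thesis unfolding eqv_def using permutes_compose[OF f(1) g(1)] by blast
qed

lemma eqv_sub:
  assumes "eqv a b l" "c + l' \<le> l"
  shows "eqv (a + c) (b + c) l'"
proof -
  obtain f where f: "f permutes {..<K}" "\<And>i. i < l \<Longrightarrow> f (W (a + i)) = W (b + i)"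
    using assms(1) unfolding eqv_def by blast
  have "f (W (a + c + i)) = W (b + c + i)" if "i < l'" for i
    using f(2)[of "c + i"] assms(2) that by (simp add: add.assoc)
  then show ?thesis unfolding eqv_def using f(1) by blast
qed

lemma eqv_take: "eqv a b l \<Longrightarrow> l' \<le> l \<Longrightarrow> eqv a b l'"
  using eqv_sub[of a b l 0 l'] by simp

text \<open>Two matches of prefixes at distance \<open>\<delta>\<close> overlap in
  \<open>j - \<delta>\<close> letters. Comparing both with this common factor shows that
  \<open>\<delta>\<close> is a p-period of the prefix of length \<open>j\<close>.\<close>

lemma eqv_overlap:
  assumes "eqv 0 p j" "eqv 0 (p + \<delta>) (j - \<delta>)" "\<delta> \<le> j"
  shows "eqv 0 \<delta> (j - \<delta>)"
proof -
  have "eqv (0 + \<delta>) (p + \<delta>) (j - \<delta>)" by (rule eqv_sub[OF assms(1)]) (use assms in simp)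
  then have "eqv (p + \<delta>) \<delta> (j - \<delta>)" using eqv_sym by simp
  then show ?thesis by (rule eqv_trans[OF assms(2)])
qed

section \<open>First occurrences and extension of a match by one letter\<close>

definition fst_occ :: "nat \<Rightarrow> nat" where
  "fst_occ x = (LEAST d. W d = x)"

lemma fst_occ: "W (fst_occ (W d)) = W d" "fst_occ (W d) \<le> d"
  "fst_occ (W d) = d \<longleftrightarrow> (\<forall>d'<d. W d' \<noteq> W d)"
proof -
  show 1: "W (fst_occ (W d)) = W d" unfolding fst_occ_def by (rule LeastI) simp
  show 2: "fst_occ (W d) \<le> d" unfolding fst_occ_def by (rule Least_le) simp
  show "fst_occ (W d) = d \<longleftrightarrow> (\<forall>d'<d. W d' \<noteq> W d)"
    using 1 2 not_less_Least[of _ "\<lambda>d'. W d' = W d"] unfolding fst_occ_def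
    by (metis le_neq_implies_less)
qed

lemma eqv_Suc:
  assumes "eqv 0 p j"
  shows "eqv 0 p (Suc j) \<longleftrightarrow>
    (if W j < K
     then W (p + j) < K \<and>
       (if fst_occ (W j) < j then W (p + fst_occ (W j)) = W (p + j)
        else (\<forall>d<j. W (p + d) \<noteq> W (p + j)))
     else W j = W (p + j))"
proof -
  let ?f = "fst_occ (W j)"
  have A: "(W i < K \<longleftrightarrow> W (p + i) < K)" "\<not> W i < K \<Longrightarrow> W i = W (p + i)"
      "i' < j \<Longrightarrow> W i = W i' \<longleftrightarrow> W (p + i) = W (p + i')" if "i < j" for i i'
    using assms that unfolding eqv_iff add_0 by blast+
  have "eqv 0 p (Suc j) \<longleftrightarrow> (W j < K \<longleftrightarrow> W (p + j) < K) \<and> (\<not> W j < K \<longrightarrow> W j = W (p + j)) \<and>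
      (\<forall>i<j. W j = W i \<longleftrightarrow> W (p + j) = W (p + i))"
    (is "_ \<longleftrightarrow> ?R")
  proof
    assume "eqv 0 p (Suc j)"
    then show ?R unfolding eqv_iff add_0 All_less_Suc by blast
  next
    assume R: ?R
    have "W i = W i' \<longleftrightarrow> W (p + i) = W (p + i')" if "i < Suc j" "i' < Suc j" for i i'
    proof (cases "i = j"; cases "i' = j")
      assume "i \<noteq> j" "i' = j"
      then show ?thesis using R that by (metis less_SucE)
    qed (use R A(3)[of i i'] that in \<open>simp_all\<close>)
    moreover have "(W i < K \<longleftrightarrow> W (p + i) < K) \<and> (\<not> W i < K \<longrightarrow> W i = W (p + i))" if "i < Suc j" for i
      using conjunct1[OF R] conjunct1[OF conjunct2[OF R]] A(1,2)[of i] that unfolding less_Suc_eq by blast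
    ultimately show "eqv 0 p (Suc j)" unfolding eqv_iff add_0 by blast
  qed
  also have "\<dots> \<longleftrightarrow> (if W j < K
     then W (p + j) < K \<and>
       (if ?f < j then W (p + ?f) = W (p + j)
        else (\<forall>d<j. W (p + d) \<noteq> W (p + j)))
     else W j = W (p + j))"
  proof (cases "W j < K")
    case False
    have "W j = W i \<longleftrightarrow> W j = W (p + i)" if "i < j" for i
      using A(1,2)[OF that] False by (cases "W i < K") auto
    then show ?thesis using False by auto
  next
    case K: True
    show ?thesis
    proof (cases "?f < j")
      case f: True
      have "W j = W i \<longleftrightarrow> W (p + ?f) = W (p + i)" if "i < j" for i
        using A(3)[OF f that] fst_occ(1)[of j] by simp
      then show ?thesis using K f fst_occ(1)[of j] A(1)[OF f] by auto
    next
      case False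
      then have "W i \<noteq> W j" if "i < j" for i using fst_occ(2,3)[of j] that by auto
      then have "(\<forall>i<j. W j = W i \<longleftrightarrow> W (p + j) = W (p + i)) \<longleftrightarrow> (\<forall>d<j. W (p + d) \<noteq> W (p + j))"
        by metis
      then show ?thesis using K False by simp
    qed
  qed
  finally show ?thesis .
qed

text \<open>There is one position for each distinct parameter of the prefix, which makes
  \<open>\<kappa>\<close> below the number of parameters of the pattern.\<close>

definition firsts :: "nat \<Rightarrow> nat list" where
  "firsts l = filter (\<lambda>d. W d < K \<and> fst_occ (W d) = d) [0..<l]"

lemma set_firsts: "set (firsts l) = {d. d < l \<and> W d < K \<and> fst_occ (W d) = d}"
  by (auto simp: firsts_def)

lemma length_firsts: "length (firsts l) = card (W ` {..<l} \<inter> {..<K})"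
proof -
  have d: "distinct (firsts l)" by (simp add: firsts_def)
  have "inj_on W (set (firsts l))" unfolding set_firsts by (rule inj_onI) (metis (mono_tags, lifting) mem_Collect_eq)
  moreover have "W ` set (firsts l) = W ` {..<l} \<inter> {..<K}"
  proof (intro equalityI subsetI)
    fix x assume "x \<in> W ` {..<l} \<inter> {..<K}"
    then obtain d where d: "d < l" "x = W d" "x < K" by auto
    have "fst_occ (W d) \<in> set (firsts l)" "x = W (fst_occ (W d))"
      using d fst_occ[of d] unfolding set_firsts by auto
    then show "x \<in> W ` set (firsts l)" by blast
  qed (auto simp: set_firsts)
  ultimately have "card (set (firsts l)) = card (W ` {..<l} \<inter> {..<K})"
    by (metis card_image)
  then show ?thesis using distinct_card[OF d] by simp
qed

lemma length_firsts_le: "length (firsts l) \<le> K"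
  unfolding length_firsts using card_mono[of "{..<K}" "W ` {..<l} \<inter> {..<K}"] by simp

section \<open>Exhaustion of the parameters and differences of periods\<close>

abbreviation "\<kappa> \<equiv> length (firsts m)"

text \<open>The first \<open>\<kappa>\<close> blocks of a period \<open>p\<close> exhaust the
  parameters; the four further blocks leave room for two steps by a period
  \<open>q < 2 p\<close>.\<close>

definition k :: nat where
  "k = \<kappa> + 4"

text \<open>Each block of length \<open>p\<close> of a string with p-period \<open>p\<close> either contributes a new parameter
  or is the last one to matter, so \<open>\<kappa>\<close> blocks exhaust the parameters.\<close>

lemma params_stabilise:
  assumes f: "f permutes {..<K}" and p: "\<And>i. i + p < c * p \<Longrightarrow> W (i + p) = f (W i)"
    and c: "c * p \<le> m" and i: "i < c * p" and Wi: "W i < K"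
  shows "\<exists>i'<\<kappa> * p. W i' = W i"
proof -
  define A where "A t = W ` {..<t * p} \<inter> {..<K}" for t
  have fin: "finite (A t)" for t by (simp add: A_def)
  have mono: "A t \<subseteq> A t'" if "t \<le> t'" for t t'
  proof -
    have "{..<t * p} \<subseteq> {..<t' * p}" using mult_le_mono1[OF that, of p] by simp
    then show ?thesis unfolding A_def by (intro Int_mono image_mono order_refl)
  qed
  \<comment> \<open>The last of the \<open>Suc t\<close> blocks is the image under \<open>f\<close>
    of the block before it, which exists only for \<open>0 < t\<close>.\<close>
  have step: "A (Suc t) \<subseteq> A t \<union> f ` A t" if "Suc t \<le> c" "0 < t" for t
  proof
    fix x assume "x \<in> A (Suc t)"
    then obtain i where i: "i < Suc t * p" "x = W i" "x < K" by (auto simp: A_def)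
    have le: "Suc t * p \<le> c * p" by (rule mult_le_mono1) (rule that(1))
    show "x \<in> A t \<union> f ` A t"
    proof (cases "i < t * p")
      case False
      have "p \<le> t * p" using that(2) by (cases t) simp_all
      then have ip: "i - p + p = i" "i - p < t * p"
        using False i(1) unfolding mult_Suc by linarith+
      have "x = f (W (i - p))" using p[of "i - p"] i ip le by simp
      moreover have "W (i - p) < K" using calculation i(3) permutes_in_image[OF f, of "W (i - p)"] by simp
      ultimately show ?thesis using ip by (auto simp: A_def)
    qed (use i in \<open>auto simp: A_def\<close>)
  qed
  have fstep: "f ` A t \<subseteq> A (Suc t)" if "Suc t \<le> c" for t
  proof
    fix x assume "x \<in> f ` A t"
    then obtain i where i: "i < t * p" "x = f (W i)" "W i < K" by (auto simp: A_def)
    have "Suc t * p \<le> c * p" by (rule mult_le_mono1) (rule that)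
    then have "i + p < c * p" using i by simp
    then have "W (i + p) = x" using p i by simp
    then show "x \<in> A (Suc t)" using i permutes_in_image[OF f, of "W i"]
      by (auto simp: A_def intro!: image_eqI[where x="i + p"])
  qed
  \<comment> \<open>If one block adds no parameter, \<open>f\<close> maps the set found so far into
    itself, so later blocks add none either.\<close>
  have stable: "A t' \<subseteq> A t" if "A (Suc t) = A t" "Suc t \<le> c" "t' \<le> c" "0 < t" for t t'
    using that(3)
  proof (induction t')
    case 0
    then show ?case by (simp add: A_def)
  next
    case (Suc t')
    show ?case
    proof (cases "t' = 0")
      case True
      then show ?thesis using mono[of "Suc t'" t] that by simp
    next
      case False
      then have "A (Suc t') \<subseteq> A t' \<union> f ` A t'" using step Suc.prems by simp
      also have "\<dots> \<subseteq> A t" using Suc fstep[of t] that by auto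
      finally show ?thesis .
    qed
  qed
  have card_le: "card (A c) \<le> \<kappa>"
    unfolding length_firsts A_def by (rule card_mono) (use c in auto)
  have "A c \<subseteq> A \<kappa>"
  proof (rule ccontr)
    assume neg: "\<not> A c \<subseteq> A \<kappa>"
    then have lt: "\<kappa> < c" using mono[of c \<kappa>] by fastforce
    \<comment> \<open>The sets would grow strictly up to stage \<open>Suc \<kappa>\<close> and so
      contain more than \<open>\<kappa>\<close> parameters.\<close>
    have "t \<le> card (A t) \<and> A t \<noteq> A (Suc t)" if "t \<le> \<kappa>" for t
      using that
    proof (induction t)
      case 0
      have "A 1 \<noteq> {}"
      proof
        assume "A 1 = {}"
        have "A t = {}" if "t \<le> c" for t using that
        proof (induction t)
          case (Suc t)
          then show ?case using step[of t] \<open>A 1 = {}\<close> by (cases "t = 0") auto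
        qed (simp add: A_def)
        then show False using neg by simp
      qed
      then show ?case by (simp add: A_def)
    next
      case (Suc t)
      then have "A t \<subset> A (Suc t)" using mono[of t "Suc t"] by auto
      then have "card (A t) < card (A (Suc t))" using fin psubset_card_mono by blast
      then have 1: "Suc t \<le> card (A (Suc t))" using Suc by simp
      have "A (Suc t) \<noteq> A (Suc (Suc t))"
      proof
        assume "A (Suc t) = A (Suc (Suc t))"
        then have "A c \<subseteq> A (Suc t)" using stable[of "Suc t" c] Suc.prems lt by simp
        then show False using neg mono[OF Suc.prems] by blast
      qed
      with 1 show ?case by simp
    qed
    then have "\<kappa> \<le> card (A \<kappa>)" "A \<kappa> \<noteq> A (Suc \<kappa>)" by auto
    moreover have "card (A \<kappa>) < card (A (Suc \<kappa>))"
      using calculation mono[of \<kappa> "Suc \<kappa>"] fin by (intro psubset_card_mono) auto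
    moreover have "card (A (Suc \<kappa>)) \<le> card (A c)"
      using mono[of "Suc \<kappa>" c] lt fin by (intro card_mono) auto
    ultimately show False using card_le by simp
  qed
  moreover have "W i \<in> A c" using i Wi by (auto simp: A_def)
  ultimately have "W i \<in> W ` {..<\<kappa> * p}" unfolding A_def by blast
  then show ?thesis by auto
qed

text \<open>The permutations \<open>f\<close> and \<open>g\<close> belonging to \<open>p\<close> and
  \<open>q\<close> commute on the letters of the prefix: from one of the first
  \<open>\<kappa> p\<close> positions, going right by \<open>p\<close> and then \<open>q\<close>
  reaches the same letter as \<open>q\<close> and then \<open>p\<close>. Hence
  \<open>inv f \<circ> g\<close> describes the shift by \<open>q - p\<close>. The period
  \<open>p\<close> is assumed only up to length \<open>k p\<close>, since an earlier scope has a
  shorter reach than a later one.\<close>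

lemma period_diff:
  assumes pq: "0 < p" "p < q" "q < 2 * p"
    and r: "r \<le> m" "k * q \<le> r"
    and Mp: "eqv 0 p (k * p - p)" and Mq: "eqv 0 q (r - q)"
  shows "eqv 0 (q - p) (r - (q - p))"
proof -
  obtain f where f: "f permutes {..<K}" and f1: "\<And>i. i < k * p - p \<Longrightarrow> f (W i) = W (p + i)"
    using Mp unfolding eqv_def by auto
  obtain g where g: "g permutes {..<K}" and g1: "\<And>i. i < r - q \<Longrightarrow> g (W i) = W (q + i)"
    using Mq unfolding eqv_def by auto
  have kr: "k * p \<le> r" using pq r by (meson le_trans less_imp_le mult_le_mono2)
  have k3: "\<kappa> * p + 4 * p \<le> k * p" by (simp add: k_def add_mult_distrib)
  have f2: "W (i + p) = f (W i)" if "i + p < k * p" for i using f1[of i] that by (simp add: add.commute)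
  have g2: "W (i + q) = g (W i)" if "i + q < r" for i using g1[of i] that by (simp add: add.commute)
  have stab: "\<exists>i'<\<kappa> * p. W i' = W i" if "i < k * p" "W i < K" for i
    by (rule params_stabilise[OF f, of p k]) (use f2 kr r that in auto)
  have com0: "f (g (W i)) = g (f (W i))" if "i + p + q < k * p" for i
    using that f2[of i] g2[of i] f2[of "i + q"] g2[of "i + p"] kr by (simp add: ac_simps)
  \<comment> \<open>Beyond \<open>k p\<close> only \<open>q\<close> is known to be a period: go back
    by \<open>q\<close>, take an equal letter among the first \<open>\<kappa> p\<close> positions,
    come forward by \<open>q\<close> and apply \<open>stab\<close>.\<close>
  have inA: "\<exists>i'<\<kappa> * p. W i' = W i" if "i < r" "W i < K" for i
    using that
  proof (induction i rule: less_induct)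
    case (less i)
    show ?case
    proof (cases "i < k * p")
      case True then show ?thesis using stab less by simp
    next
      case False
      then have iq: "i - q + q = i" "i - q < i" using k3 pq by auto
      then have Wi: "W i = g (W (i - q))" using g2[of "i - q"] less.prems by simp
      then have "W (i - q) < K" using less.prems permutes_in_image[OF g, of "W (i - q)"] by simp
      then obtain i' where i': "i' < \<kappa> * p" "W i' = W (i - q)" using less iq by fastforce
      then have "W (i' + q) = W i" using g2[of i'] Wi k3 kr pq by simp
      then show ?thesis using stab[of "i' + q"] i' k3 pq less.prems by simp
    qed
  qed
  have com: "f (g (W i)) = g (f (W i))" if "i < r" for i
  proof (cases "W i < K")
    case True
    then obtain i' where "i' < \<kappa> * p" "W i' = W i" using inA[of i] \<open>i < r\<close> by auto
    then show ?thesis using com0[of i'] k3 pq by simp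
  next
    case False
    then show ?thesis using permutes_not_in[OF f] permutes_not_in[OF g] by simp
  qed
  define d where "d = q - p"
  have d: "q = p + d" using pq by (simp add: d_def)
  \<comment> \<open>For \<open>i < q\<close> both sides are the letter at \<open>i + q\<close>;
    later positions are reduced by \<open>q\<close>, moving \<open>g\<close> past
    \<open>f\<close>.\<close>
  have shift: "f (W (i + d)) = g (W i)" if "i + d < r" for i
    using that
  proof (induction i rule: less_induct)
    case (less i)
    show ?case
    proof (cases "i < q")
      case True
      then have "i + d + p < k * p" using pq k3 d by simp
      then show ?thesis using f2[of "i + d"] g2[of i] kr d by (simp add: ac_simps)
    next
      case False
      then have iq: "i - q + q = i" "i - q < i" "i - q + d + q = i + d" using pq by auto
      have "f (W (i + d)) = f (g (W (i - q + d)))"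
        using g2[of "i - q + d"] less.prems iq by simp
      also have "\<dots> = g (f (W (i - q + d)))" using com[of "i - q + d"] less.prems by simp
      also have "\<dots> = g (g (W (i - q)))"
        using less.IH[OF iq(2)] less.prems iq(3) by (metis add_lessD1)
      also have "\<dots> = g (W i)" using g2[of "i - q"] iq less.prems by simp
      finally show ?thesis .
    qed
  qed
  have "inv f \<circ> g permutes {..<K}" using permutes_compose[OF g permutes_inv[OF f]] .
  moreover have "(inv f \<circ> g) (W (0 + i)) = W (d + i)" if "i < r - d" for i
    using shift[of i] that permutes_inv_eq[OF f] by (simp add: add.commute)
  ultimately show ?thesis unfolding eqv_def d_def by blast
qed

section \<open>Safe shifts and scopes\<close>

lemma k_ge: "4 \<le> k"
  by (simp add: k_def)

text \<open>A smaller positive shift would have to be a p-period of the \<open>j\<close> matched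
  letters; as none is, the positions skipped can carry no match.\<close>

definition safe_shift :: "nat \<Rightarrow> nat \<Rightarrow> bool" where
  "safe_shift j s \<longleftrightarrow> 1 \<le> s \<and> s \<le> Suc j \<and> (\<forall>\<delta>. 1 \<le> \<delta> \<and> \<delta> < s \<longrightarrow> \<not> eqv 0 \<delta> (j - \<delta>))"

definition sound_scopes :: "nat \<Rightarrow> (nat \<times> nat) list \<Rightarrow> bool" where
  "sound_scopes p L \<longleftrightarrow> sorted_wrt (\<lambda>(q, r) (q', r'). q < q' \<and> r < r') L \<and>
    (\<forall>(q, r) \<in> set L. 1 \<le> q \<and> q < p \<and> k * q \<le> r \<and> r \<le> m \<and> eqv 0 q (r - q) \<and>
      (\<forall>q'. 1 \<le> q' \<and> q' < q \<longrightarrow> \<not> eqv 0 q' (r - q')))"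

text \<open>Domination takes the place of maximality of \<open>r\<close>: both components increase
  along the list, as \<open>sound_scopes\<close> demands, so a listed \<open>q\<close> cannot be a
  p-period of a prefix of the pattern longer than its listed reach.\<close>

definition complete_scopes :: "nat \<Rightarrow> (nat \<times> nat) list \<Rightarrow> bool" where
  "complete_scopes p L \<longleftrightarrow> (\<forall>q r. 1 \<le> q \<and> q < p \<and> k * q \<le> r \<and> r \<le> m \<and> eqv 0 q (r - q) \<longrightarrow>
    (\<exists>(q', r') \<in> set L. q' \<le> q \<and> r \<le> r'))"

definition scopes :: "nat \<Rightarrow> (nat \<times> nat) list \<Rightarrow> bool" where
  "scopes p L \<longleftrightarrow> sound_scopes p L \<and> complete_scopes p L"

lemma complete_scopesD:
  assumes "complete_scopes p L" "1 \<le> q" "q < p" "k * q \<le> r" "r \<le> m" "eqv 0 q (r - q)"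
  obtains q' r' where "(q', r') \<in> set L" "q' \<le> q" "r \<le> r'"
  using assms unfolding complete_scopes_def by blast

lemma sound_scopesD:
  assumes "sound_scopes p L" "(q, r) \<in> set L"
  shows "1 \<le> q" "q < p" "k * q \<le> r" "r \<le> m" "eqv 0 q (r - q)"
    "1 \<le> q' \<Longrightarrow> q' < q \<Longrightarrow> \<not> eqv 0 q' (r - q')"
  using assms unfolding sound_scopes_def by blast+

lemma scopes_Nil: "scopes 1 []"
  by (simp add: scopes_def sound_scopes_def complete_scopes_def)

text \<open>The default 0 lies below every reach, since a reach is at least \<open>k q\<close> with
  \<open>q \<ge> 1\<close>.\<close>

definition last_reach :: "(nat \<times> nat) list \<Rightarrow> nat" where
  "last_reach L = (if L = [] then 0 else snd (last L))"

lemma le_last_reach: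
  assumes "sound_scopes p L" "(q, r) \<in> set L"
  shows "r \<le> last_reach L"
proof -
  obtain i where i: "i < length L" "L ! i = (q, r)" using assms(2) by (meson in_set_conv_nth)
  have "L \<noteq> []" using i by auto
  show ?thesis
  proof (cases "i = length L - 1")
    case True
    then show ?thesis using i \<open>L \<noteq> []\<close> by (simp add: last_reach_def last_conv_nth)
  next
    case False
    then have "snd (L ! i) < snd (L ! (length L - 1))"
      using assms(1) i sorted_wrt_nth_less[of _ L i "length L - 1"]
      unfolding sound_scopes_def by fastforce
    then show ?thesis using i \<open>L \<noteq> []\<close> by (simp add: last_reach_def last_conv_nth)
  qed
qed

text \<open>A match may run on into the text, whereas reaches are lengths within the pattern, hence
  \<open>min\<close>. A pair with \<open>k p \<le> r\<close> that does not exceed the last reach is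
  dominated by the last scope.\<close>

definition insert_scope :: "nat \<Rightarrow> nat \<Rightarrow> (nat \<times> nat) list \<Rightarrow> (nat \<times> nat) list" where
  "insert_scope p j L =
    (let r = min m (p + j) in if k * p \<le> r \<and> last_reach L < r then L @ [(p, r)] else L)"

text \<open>Maximality of \<open>j\<close> makes \<open>min m (p + j)\<close> the length of the
  longest prefix of the pattern with p-period \<open>p\<close>. A smaller p-period of that prefix
  would be dominated by a scope of at least this reach, which \<open>last_reach L < r\<close>
  excludes.\<close>

lemma scopes_insert:
  assumes L: "scopes p L" and p: "1 \<le> p" and j: "eqv 0 p j" "j \<le> m"
    and max: "j = m \<or> \<not> eqv 0 p (Suc j)"
  shows "scopes (Suc p) (insert_scope p j L)"
proof -
  define r where "r = min m (p + j)"
  have sound: "sound_scopes p L" and compl: "complete_scopes p L" using L by (auto simp: scopes_def)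
  have reach: "r' \<le> r" if "k * p \<le> r'" "r' \<le> m" "eqv 0 p (r' - p)" for r'
  proof (rule ccontr)
    assume "\<not> r' \<le> r"
    then have "p + j < r'" "j < m" using that by (auto simp: r_def)
    then have "eqv 0 p (Suc j)" using eqv_take[OF that(3), of "Suc j"] by simp
    then show False using max \<open>j < m\<close> by simp
  qed
  show ?thesis
  proof (cases "k * p \<le> r \<and> last_reach L < r")
    case True
    have eq: "insert_scope p j L = L @ [(p, r)]" using True by (simp add: insert_scope_def r_def)
    have "\<not> eqv 0 q (r - q)" if q: "1 \<le> q" "q < p" for q
    proof
      assume *: "eqv 0 q (r - q)"
      have "k * q \<le> r" using q True by (meson le_trans less_imp_le mult_le_mono2)
      then obtain q' r' where "(q', r') \<in> set L" "r \<le> r'"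
        using complete_scopesD[OF compl q _ _ *] by (metis min.cobounded1 r_def)
      then show False using le_last_reach[OF sound] True by fastforce
    qed
    moreover have "q < p \<and> r' < r" if "(q, r') \<in> set L" for q r'
      using sound_scopesD(2)[OF sound that] le_last_reach[OF sound that] True by simp
    moreover have "eqv 0 p (r - p)" using eqv_take[OF j(1), of "r - p"] by (simp add: r_def)
    ultimately have "sound_scopes (Suc p) (L @ [(p, r)])"
      using sound p True unfolding sound_scopes_def
      by (fastforce simp: sorted_wrt_append r_def[symmetric] less_Suc_eq intro: min.cobounded1[of m "p + j", folded r_def])
    moreover have "complete_scopes (Suc p) (L @ [(p, r)])"
      unfolding complete_scopes_def
    proof (intro allI impI)
      fix q r' assume a: "1 \<le> q \<and> q < Suc p \<and> k * q \<le> r' \<and> r' \<le> m \<and> eqv 0 q (r' - q)"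
      show "\<exists>(q', r'')\<in>set (L @ [(p, r)]). q' \<le> q \<and> r' \<le> r''"
      proof (cases "q = p")
        case True
        then show ?thesis using reach[of r'] a by auto
      next
        case False
        then obtain q' r'' where "(q', r'') \<in> set L" "q' \<le> q" "r' \<le> r''"
          using complete_scopesD[OF compl, of q r'] a by (metis less_SucE)
        then show ?thesis by auto
      qed
    qed
    ultimately show ?thesis by (simp add: eq scopes_def)
  next
    case False
    have eq: "insert_scope p j L = L" using False by (auto simp: insert_scope_def r_def Let_def)
    have "sound_scopes (Suc p) L" using sound unfolding sound_scopes_def by fastforce
    moreover have "complete_scopes (Suc p) L"
      unfolding complete_scopes_def
    proof (intro allI impI)
      fix q r' assume a: "1 \<le> q \<and> q < Suc p \<and> k * q \<le> r' \<and> r' \<le> m \<and> eqv 0 q (r' - q)"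
      show "\<exists>(q', r'')\<in>set L. q' \<le> q \<and> r' \<le> r''"
      proof (cases "q = p")
        case True
        have r': "r' \<le> r" using reach[of r'] a True by simp
        moreover have "0 < k * p" using p k_ge by simp
        moreover have "k * p \<le> r'" using a True by simp
        ultimately have "0 < r" by linarith
        then have "r \<le> last_reach L" using False \<open>k * p \<le> r'\<close> r' by linarith
        with \<open>0 < r\<close> have "L \<noteq> []" by (auto simp: last_reach_def)
        obtain q' r'' where l: "last L = (q', r'')" by fastforce
        then have "(q', r'') \<in> set L" using last_in_set[OF \<open>L \<noteq> []\<close>] by simp
        moreover have "r' \<le> r''" using \<open>r \<le> last_reach L\<close> l \<open>L \<noteq> []\<close> r' by (simp add: last_reach_def)
        moreover have "q' \<le> q" using sound_scopesD(2)[OF sound calculation(1)] True by simp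
        ultimately show ?thesis by auto
      next
        case False
        then show ?thesis
          using complete_scopesD[OF compl, of q r'] a by (metis (mono_tags, lifting) case_prodI less_SucE)
      qed
    qed
    ultimately show ?thesis by (simp add: eq scopes_def)
  qed
qed

text \<open>The sentinel \<open>(Suc m, m)\<close> makes every search for a reach of at least
  \<open>j\<close> succeed; its period exceeds \<open>j\<close>, so it can only lead to the shift by
  \<open>Suc (j div k)\<close>. That shift is safe because in this case no p-period
  \<open>\<delta>\<close> of the matched prefix has \<open>k \<delta> \<le> j\<close>.\<close>

lemma safe_shift_lookup:
  assumes L: "scopes (Suc p) L" and p: "1 \<le> p" and j: "eqv 0 p j" "j \<le> m"
    and i: "i \<le> length L" "(L @ [(Suc m, m)]) ! i = (q, r)" "j \<le> r"
    and before: "\<And>i'. i' < i \<Longrightarrow> snd ((L @ [(Suc m, m)]) ! i') < j"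
  shows "safe_shift j (if k * q \<le> j then q else Suc (j div k))"
    and "k * q \<le> j \<Longrightarrow> eqv 0 q (j - q)"
proof -
  have sound: "sound_scopes (Suc p) L" and compl: "complete_scopes (Suc p) L"
    using L by (auto simp: scopes_def)
  \<comment> \<open>Reaches before index \<open>i\<close> are below \<open>j\<close>, so a scope
    that reaches \<open>j\<close> stands at \<open>i\<close> or later, where periods are no
    smaller.\<close>
  have later: "q \<le> q'" if q': "(q', r') \<in> set L" "j \<le> r'" for q' r'
  proof -
    obtain i' where i': "i' < length L" "L ! i' = (q', r')" using q'(1) by (meson in_set_conv_nth)
    have "i \<le> i'" using before[of i'] i' q' by (force simp: nth_append not_less[symmetric])
    then have "i < length L" using i' by simp
    then have "(q, r) = L ! i" using i by (simp add: nth_append)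
    then show ?thesis
      using sound i' \<open>i \<le> i'\<close> sorted_wrt_nth_less[of _ L i i']
      unfolding sound_scopes_def by (cases "i = i'") fastforce+
  qed
  have kq: "1 \<le> q \<and> q \<le> j \<and> eqv 0 q (j - q) \<and> q \<le> p" if "k * q \<le> j"
  proof -
    have "q \<le> j" using that k_ge by (metis le_trans mult_le_mono1 mult_1 one_le_numeral)
    then have "i \<noteq> length L" using i j by auto
    then have "(q, r) \<in> set L" using i by (simp add: nth_append) (metis le_neq_implies_less nth_mem)
    from sound_scopesD[OF sound this] show ?thesis
      using \<open>q \<le> j\<close> eqv_take[of 0 q "r - q" "j - q"] i(3) by auto
  qed
  then show "k * q \<le> j \<Longrightarrow> eqv 0 q (j - q)" by simp
  have min: "q \<le> \<delta>" if d: "1 \<le> \<delta>" "k * \<delta> \<le> j" "eqv 0 \<delta> (j - \<delta>)" "\<delta> \<le> p" for \<delta>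
  proof -
    obtain q' r' where "(q', r') \<in> set L" "q' \<le> \<delta>" "j \<le> r'"
      using complete_scopesD[OF compl d(1) _ d(2) j(2) d(3)] d(4) by auto
    then show ?thesis using later[of q' r'] by simp
  qed
  show "safe_shift j (if k * q \<le> j then q else Suc (j div k))"
  proof (cases "k * q \<le> j")
    case True
    have "\<not> eqv 0 \<delta> (j - \<delta>)" if "1 \<le> \<delta>" "\<delta> < q" for \<delta>
    proof
      assume "eqv 0 \<delta> (j - \<delta>)"
      moreover have "k * \<delta> \<le> j" using that True by (meson le_trans less_imp_le mult_le_mono2)
      ultimately have "q \<le> \<delta>" using min that kq[OF True] by simp
      then show False using that by simp
    qed
    then show ?thesis using kq True by (simp add: safe_shift_def)
  next
    case False
    have "\<not> eqv 0 \<delta> (j - \<delta>)" if "1 \<le> \<delta>" "\<delta> < Suc (j div k)" for \<delta>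
    proof
      assume *: "eqv 0 \<delta> (j - \<delta>)"
      have kd: "k * \<delta> \<le> j" using that
        by (metis less_Suc_eq_le le_trans mult_le_mono2 times_div_less_eq_dividend)
      show False
      proof (cases "\<delta> \<le> p")
        case True
        then have "q \<le> \<delta>" using min that kd * by simp
        then show False using False kd by (meson le_trans mult_le_mono2)
      next
        case d: False
        \<comment> \<open>Completeness says nothing about \<open>\<delta> > p\<close>, but then
          \<open>p\<close> itself is short enough, and the current match makes it a p-period of the
          matched prefix.\<close>
        then have kp: "k * p \<le> j" using kd by (meson le_trans nat_le_linear mult_le_mono2)
        then have "q \<le> p" using min[of p] p j eqv_take[OF j(1)] by simp
        then show False using kp False by (meson le_trans mult_le_mono2)
      qed
    qed
    then show ?thesis using False by (simp add: safe_shift_def)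
  qed
qed

lemma no_match_skipped:
  assumes "eqv 0 p j" "safe_shift j s" "p < x" "x < p + s"
  shows "\<not> eqv 0 x (p + j - x)"
proof -
  define \<delta> where "\<delta> = x - p"
  have \<delta>: "x = p + \<delta>" "1 \<le> \<delta>" "\<delta> < s" "\<delta> \<le> j" using assms by (auto simp: \<delta>_def safe_shift_def)
  then show ?thesis
    using eqv_overlap[OF assms(1), of \<delta>] assms(2) by (auto simp: safe_shift_def)
qed

text \<open>A skipped position \<open>q\<close> brings no new scope: a reach of at least
  \<open>p + j\<close> would contradict the safety of the shift, and a prefix shorter than that has
  the smaller p-period \<open>p\<close> as well.\<close>

lemma scopes_skip:
  assumes L: "scopes (Suc p) L" and p: "1 \<le> p" and j: "eqv 0 p j" and s: "safe_shift j s"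
  shows "scopes (p + s) L"
proof -
  have sound: "sound_scopes (Suc p) L" and compl: "complete_scopes (Suc p) L"
    using L by (auto simp: scopes_def)
  have "sound_scopes (p + s) L"
    using sound s unfolding sound_scopes_def safe_shift_def by fastforce
  moreover have "complete_scopes (p + s) L"
    unfolding complete_scopes_def
  proof (intro allI impI)
    fix q r assume a: "1 \<le> q \<and> q < p + s \<and> k * q \<le> r \<and> r \<le> m \<and> eqv 0 q (r - q)"
    show "\<exists>(q', r')\<in>set L. q' \<le> q \<and> r \<le> r'"
    proof (cases "q \<le> p")
      case True
      then obtain q' r' where "(q', r') \<in> set L" "q' \<le> q" "r \<le> r'"
        using complete_scopesD[OF compl, of q r] a by auto
      then show ?thesis by blast
    next
      case False
      have "r < p + j"
      proof (rule ccontr)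
        assume "\<not> r < p + j"
        then have "eqv 0 q (p + j - q)" using eqv_take[of 0 q "r - q" "p + j - q"] a by simp
        then show False using no_match_skipped[OF j s, of q] False a by simp
      qed
      then have "eqv 0 p (r - p)" using eqv_take[OF j, of "r - p"] by simp
      moreover have "k * p \<le> r" using False a by (meson le_trans nat_le_linear mult_le_mono2)
      ultimately obtain q' r' where "(q', r') \<in> set L" "q' \<le> p" "r \<le> r'"
        using complete_scopesD[OF compl, of p r] a p by auto
      then show ?thesis using False by (intro bexI[of _ "(q', r')"]) auto
    qed
  qed
  ultimately show ?thesis by (simp add: scopes_def)
qed

text \<open>If a period were below twice its predecessor, \<open>period_diff\<close> would make
  their difference a smaller p-period of the longer prefix. So the periods at least double, and
  \<open>k q \<le> m\<close> for the last one limits their number.\<close>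

lemma length_scopes:
  assumes L: "scopes p L" and m: "1 \<le> m"
  shows "2 ^ length L \<le> m"
proof -
  have sound: "sound_scopes p L" using L by (simp add: scopes_def)
  have double: "2 * fst (L ! i) \<le> fst (L ! Suc i)" if i: "Suc i < length L" for i
  proof -
    obtain q r q' r' where qr: "L ! i = (q, r)" "L ! Suc i = (q', r')" by fastforce
    have in_L: "(q, r) \<in> set L" "(q', r') \<in> set L"
      using i qr nth_mem[of i L] nth_mem[of "Suc i" L] by auto
    note 1 = sound_scopesD[OF sound in_L(1)] and 2 = sound_scopesD[OF sound in_L(2)]
    have "q < q'" using sound i qr sorted_wrt_nth_less[of _ L i "Suc i"]
      unfolding sound_scopes_def by fastforce
    have "\<not> q' < 2 * q"
    proof
      assume q': "q' < 2 * q"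
      have "eqv 0 q (k * q - q)" using eqv_take[OF 1(5), of "k * q - q"] 1(3) by simp
      then have "eqv 0 (q' - q) (r' - (q' - q))"
        using period_diff[OF _ \<open>q < q'\<close> q', of r'] 1 2 by simp
      moreover have "1 \<le> q' - q" "q' - q < q'" using 1(1) \<open>q < q'\<close> by linarith+
      ultimately show False using 2(6) by blast
    qed
    then show ?thesis using qr by simp
  qed
  have ge: "2 ^ i \<le> fst (L ! i)" if "i < length L" for i
    using that
  proof (induction i)
    case 0
    then have "(fst (L ! 0), snd (L ! 0)) \<in> set L" by simp
    then show ?case using sound_scopesD(1)[OF sound] by fastforce
  next
    case (Suc i)
    then show ?case using double[of i] by simp
  qed
  show ?thesis
  proof (cases "length L")
    case 0
    then show ?thesis using m by simp
  next
    case (Suc i)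
    then have "(fst (L ! i), snd (L ! i)) \<in> set L" by simp
    from sound_scopesD(3,4)[OF sound this] have "k * fst (L ! i) \<le> m" by simp
    moreover have "4 * 2 ^ i \<le> k * fst (L ! i)" using ge[of i] k_ge Suc by (intro mult_le_mono) auto
    ultimately show ?thesis using Suc by simp
  qed
qed

end

section \<open>Total correctness with time budgets\<close>

lemma set_reg_simps [simp]:
  "reg (set_reg r v st) r' = (if r' = r then v else reg st r')"
  "mem (set_reg r v st) = mem st"
  "out (set_reg r v st) = out st"
  by (simp_all add: set_reg_def)

lemma set_mem_simps [simp]:
  "reg (set_mem a v st) = reg st"
  "mem (set_mem a v st) = (mem st)(a := v)"
  "out (set_mem a v st) = out st"
  by (simp_all add: set_mem_def)

inductive_cases exec_SkipE: "exec T P w s Skip st t st'"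
inductive_cases exec_MoveE: "exec T P w s (Move r a) st t st'"
inductive_cases exec_OpE: "exec T P w s (Op r f a b) st t st'"
inductive_cases exec_LoadE: "exec T P w s (Load r a) st t st'"
inductive_cases exec_StoreE: "exec T P w s (Store a b) st t st'"
inductive_cases exec_ReadTE: "exec T P w s (ReadT r a) st t st'"
inductive_cases exec_ReadPE: "exec T P w s (ReadP r a) st t st'"
inductive_cases exec_EmitE: "exec T P w s (Emit a) st t st'"
inductive_cases exec_SeqE: "exec T P w s (Seq c1 c2) st t st'"
inductive_cases exec_IFE: "exec T P w s (IF q a b c1 c2) st t st'"

locale machine =
  fixes T P :: "nat list" and w s :: nat
begin

text \<open>The postcondition sees the time budget left over from \<open>t\<close>. Budgets are integers and may
  become negative; it is the loop invariants that keep them from doing so.\<close>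

definition wp :: "com \<Rightarrow> (state \<Rightarrow> int \<Rightarrow> bool) \<Rightarrow> state \<Rightarrow> int \<Rightarrow> bool" where
  "wp c Q st t \<longleftrightarrow> (\<exists>t' st'. exec T P w s c st t' st' \<and> Q st' (t - int t'))"

lemma wp_simps:
  "wp Skip Q st t \<longleftrightarrow> Q st (t - 1)"
  "wp (Move r a) Q st t \<longleftrightarrow> val st a < w \<and> Q (set_reg r (val st a) st) (t - 1)"
  "wp (Op r f a b) Q st t \<longleftrightarrow> apply_op f (val st a) (val st b) < w \<and>
    Q (set_reg r (apply_op f (val st a) (val st b)) st) (t - 1)"
  "wp (Load r a) Q st t \<longleftrightarrow> val st a < s \<and> mem st (val st a) < w \<and>
    Q (set_reg r (mem st (val st a)) st) (t - 1)"
  "wp (Store a b) Q st t \<longleftrightarrow> val st a < s \<and> val st b < w \<and>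
    Q (set_mem (val st a) (val st b) st) (t - 1)"
  "wp (ReadT r a) Q st t \<longleftrightarrow> val st a < length T \<and> T ! val st a < w \<and>
    Q (set_reg r (T ! val st a) st) (t - 1)"
  "wp (ReadP r a) Q st t \<longleftrightarrow> val st a < length P \<and> P ! val st a < w \<and>
    Q (set_reg r (P ! val st a) st) (t - 1)"
  "wp (Emit a) Q st t \<longleftrightarrow> val st a < w \<and> Q (st\<lparr>out := out st @ [val st a]\<rparr>) (t - 1)"
  by (force simp: wp_def intro: exec.intros
      elim: exec_SkipE exec_MoveE exec_OpE exec_LoadE exec_StoreE exec_ReadTE exec_ReadPE exec_EmitE)+

lemma wp_Seq: "wp (Seq c1 c2) Q st t \<longleftrightarrow> wp c1 (wp c2 Q) st t" (is "?L \<longleftrightarrow> ?R")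
proof
  assume ?L
  then obtain t1 t2 st1 st2 where "exec T P w s c1 st t1 st1" "exec T P w s c2 st1 t2 st2"
      "Q st2 (t - int (t1 + t2))"
    unfolding wp_def by (metis exec_SeqE)
  moreover have "t - int (t1 + t2) = t - int t1 - int t2" by simp
  ultimately show ?R unfolding wp_def by metis
next
  assume ?R
  then obtain t1 t2 st1 st2 where "exec T P w s c1 st t1 st1" "exec T P w s c2 st1 t2 st2"
      "Q st2 (t - int t1 - int t2)"
    unfolding wp_def by blast
  moreover have "t - int (t1 + t2) = t - int t1 - int t2" by simp
  ultimately show ?L unfolding wp_def by (metis exec.Seq)
qed

lemma wp_IF: "wp (IF q a b c1 c2) Q st t \<longleftrightarrow>
    (if holds q (val st a) (val st b) then wp c1 Q st (t - 1) else wp c2 Q st (t - 1))"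
    (is "?L \<longleftrightarrow> ?R")
proof
  assume ?L
  then obtain t' st' where e: "exec T P w s (IF q a b c1 c2) st t' st'" and Q: "Q st' (t - int t')"
    unfolding wp_def by blast
  from e obtain u where u: "t' = 1 + u"
    "if holds q (val st a) (val st b) then exec T P w s c1 st u st' else exec T P w s c2 st u st'"
    by (cases rule: exec_IFE) auto
  moreover have "t - int t' = t - 1 - int u" using u(1) by simp
  ultimately show ?R using Q unfolding wp_def by (metis (full_types))
next
  assume R: ?R
  define c where "c = (if holds q (val st a) (val st b) then c1 else c2)"
  have "wp c Q st (t - 1)" using R by (simp add: c_def split: if_splits)
  then obtain u st' where u: "exec T P w s c st u st'" "Q st' (t - 1 - int u)"
    unfolding wp_def by blast
  have "exec T P w s (IF q a b c1 c2) st (1 + u) st'"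
    using u(1) exec.IfTrue exec.IfFalse unfolding c_def by (metis (full_types))
  moreover have "t - int (1 + u) = t - 1 - int u" by simp
  ultimately show ?L using u(2) unfolding wp_def by metis
qed

lemmas wp_step = wp_simps wp_Seq wp_IF

lemma wp_mono: "wp c Q st t \<Longrightarrow> (\<And>st' t'. Q st' t' \<Longrightarrow> Q' st' t') \<Longrightarrow> wp c Q' st t"
  unfolding wp_def by blast

text \<open>The budget itself is the termination measure: each round costs at least one step, and
  the invariant keeps the budget nonnegative.\<close>

lemma wp_WHILE:
  assumes "I st t"
    and nonneg: "\<And>st t. I st t \<Longrightarrow> 0 \<le> t"
    and body: "\<And>st t. I st t \<Longrightarrow> holds q (val st a) (val st b) \<Longrightarrow> wp c I st (t - 1)"
    and exit: "\<And>st t. I st t \<Longrightarrow> \<not> holds q (val st a) (val st b) \<Longrightarrow> Q st (t - 1)"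
  shows "wp (WHILE q a b c) Q st t"
  using assms(1)
proof (induction "nat (t + 1)" arbitrary: st t rule: less_induct)
  case less
  show ?case
  proof (cases "holds q (val st a) (val st b)")
    case True
    obtain t1 st1 where 1: "exec T P w s c st t1 st1" "I st1 (t - 1 - int t1)"
      using body[OF less.prems True] unfolding wp_def by blast
    have "nat (t - 1 - int t1 + 1) < nat (t + 1)" using nonneg[OF 1(2)] by linarith
    from less.hyps[OF this 1(2)] obtain t2 st2 where
      2: "exec T P w s (WHILE q a b c) st1 t2 st2" "Q st2 (t - 1 - int t1 - int t2)"
      unfolding wp_def by blast
    have "exec T P w s (WHILE q a b c) st (1 + t1 + t2) st2"
      using exec.WhileTrue True 1(1) 2(1) by blast
    moreover have "t - int (1 + t1 + t2) = t - 1 - int t1 - int t2" by simp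
    ultimately show ?thesis using 2(2) unfolding wp_def by metis
  next
    case False
    then have "exec T P w s (WHILE q a b c) st 1 st" by (rule exec.WhileFalse)
    moreover have "Q st (t - int 1)" using exit[OF less.prems False] by simp
    ultimately show ?thesis unfolding wp_def by blast
  qed
qed

end

section \<open>The search program\<close>

abbreviation seq (infixr ";;" 55) where "c1 ;; c2 \<equiv> Seq c1 c2"

text \<open>Registers: 0--2 input lengths and alphabet size, 3 loop index, 4 \<open>\<kappa>\<close>, 5 \<open>k\<close>,
  6 current position \<open>p\<close>, 7 matched length \<open>j\<close>, 8 flag, 9--15 and 18 temporaries,
  16 last reach, 17 address of the sentinel of the scope list.

  Memory, with \<open>K\<close> the number of parameters: below \<open>K\<close> the first occurrences in the pattern plus one
  (0 for absent parameters); from \<open>K\<close> the inverse of the current matching function, an image letter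
  being mapped to a first occurrence of its preimage (entries may be stale and are verified when
  used); from \<open>2 K\<close> the list of first occurrences; from \<open>3 K\<close> the list of scopes with a sentinel.\<close>

definition read_PT :: "nat \<Rightarrow> operand \<Rightarrow> com" where
  "read_PT r a = (Op 13 Sub a (Reg 1);; IF Lt a (Reg 1) (ReadP r a) (ReadT r (Reg 13)))"

definition scan_pattern :: com where
  "scan_pattern = WHILE Lt (Reg 3) (Reg 1) (
     ReadP 9 (Reg 3);;
     IF Lt (Reg 9) (Reg 2) (
       Load 11 (Reg 9);;
       IF Eq (Reg 11) (Imm 0) (
         Op 11 Add (Reg 3) (Imm 1);; Store (Reg 9) (Reg 11);;
         Op 11 Mul (Imm 2) (Reg 2);; Op 11 Add (Reg 11) (Reg 4);; Store (Reg 11) (Reg 3);;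
         Op 4 Add (Reg 4) (Imm 1)) Skip) Skip;;
     Op 3 Add (Reg 3) (Imm 1))"

definition put_sentinel :: com where
  "put_sentinel = (Op 12 Add (Reg 1) (Imm 1);; Store (Reg 17) (Reg 12);;
     Op 11 Add (Reg 17) (Imm 1);; Store (Reg 11) (Reg 1))"

definition init_search :: com where
  "init_search = (Op 5 Add (Reg 4) (Imm 4);; Op 17 Mul (Imm 3) (Reg 2);; put_sentinel;;
     Move 6 (Imm 1);; Move 7 (Imm 0);; Move 16 (Imm 0))"

text \<open>An entry \<open>d\<close> of the inverse table counts only if \<open>d < j\<close> and
  the letter at \<open>p + d\<close> is the one looked up. Thus old entries do no harm, and a shift
  need not clear all \<open>K\<close> cells.\<close>

definition compare_params :: com where
  "compare_params = (Load 14 (Reg 9);; Op 14 Sub (Reg 14) (Imm 1);;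
     IF Lt (Reg 14) (Reg 7) (
       Op 11 Add (Reg 6) (Reg 14);; read_PT 12 (Reg 11);;
       IF Eq (Reg 12) (Reg 10) (Move 8 (Imm 1)) Skip
     ) (
       Move 8 (Imm 1);; Op 15 Add (Reg 2) (Reg 10);; Load 14 (Reg 15);;
       IF Lt (Reg 14) (Reg 7) (
         Op 11 Add (Reg 6) (Reg 14);; read_PT 12 (Reg 11);;
         IF Eq (Reg 12) (Reg 10) (Move 8 (Imm 0)) Skip) Skip;;
       IF Eq (Reg 8) (Imm 1) (Store (Reg 15) (Reg 7)) Skip))"

definition compare_letters :: com where
  "compare_letters = IF Lt (Reg 9) (Reg 2)
     (IF Lt (Reg 10) (Reg 2) compare_params Skip)
     (IF Eq (Reg 9) (Reg 10) (Move 8 (Imm 1)) Skip)"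

definition extend_step :: com where
  "extend_step = (Move 8 (Imm 0);;
     IF Lt (Reg 7) (Reg 1) (
       ReadP 9 (Reg 7);; Op 11 Add (Reg 6) (Reg 7);; read_PT 10 (Reg 11);;
       compare_letters;; Op 7 Add (Reg 7) (Reg 8)) Skip)"

definition extend_match :: com where
  "extend_match = (Move 8 (Imm 1);; WHILE Eq (Reg 8) (Imm 1) extend_step)"

definition report_match :: com where
  "report_match = IF Eq (Reg 7) (Reg 1) (IF Le (Reg 1) (Reg 6)
     (Op 11 Sub (Reg 6) (Reg 1);; Emit (Reg 11)) Skip) Skip"

definition record_scope :: com where
  "record_scope = (Op 15 Add (Reg 6) (Reg 7);;
     IF Lt (Reg 1) (Reg 15) (Move 15 (Reg 1)) Skip;;
     Op 11 Mul (Reg 5) (Reg 6);;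
     IF Le (Reg 11) (Reg 15) (IF Lt (Reg 16) (Reg 15) (
       Store (Reg 17) (Reg 6);; Op 11 Add (Reg 17) (Imm 1);; Store (Reg 11) (Reg 15);;
       Op 17 Add (Reg 17) (Imm 2);; put_sentinel;; Move 16 (Reg 15)) Skip) Skip)"

definition shift :: com where
  "shift = (Op 3 Mul (Imm 3) (Reg 2);; Op 11 Add (Reg 3) (Imm 1);; Load 15 (Reg 11);;
     WHILE Lt (Reg 15) (Reg 7)
       (Op 3 Add (Reg 3) (Imm 2);; Op 11 Add (Reg 3) (Imm 1);; Load 15 (Reg 11));;
     Load 18 (Reg 3);; Op 11 Mul (Reg 5) (Reg 18);;
     IF Le (Reg 11) (Reg 7)
       (Op 7 Sub (Reg 7) (Reg 18);; Op 6 Add (Reg 6) (Reg 18))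
       (Op 11 Div (Reg 7) (Reg 5);; Op 11 Add (Reg 11) (Imm 1);; Op 6 Add (Reg 6) (Reg 11);;
        Move 7 (Imm 0)))"

definition rebuild_inverse :: com where
  "rebuild_inverse = (Move 3 (Imm 0);; WHILE Lt (Reg 3) (Reg 4) (
     Op 11 Mul (Imm 2) (Reg 2);; Op 11 Add (Reg 11) (Reg 3);; Load 14 (Reg 11);;
     IF Lt (Reg 14) (Reg 7) (
       Op 11 Add (Reg 6) (Reg 14);; read_PT 10 (Reg 11);;
       Op 10 Add (Reg 10) (Reg 2);; Store (Reg 10) (Reg 14)) Skip;;
     Op 3 Add (Reg 3) (Imm 1)))"

definition search_loop :: com where
  "search_loop = WHILE Le (Reg 6) (Reg 0)
     (extend_match;; report_match;; record_scope;; shift;; rebuild_inverse)"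

definition p_search :: com where
  "p_search = IF Lt (Reg 0) (Reg 1) Skip (scan_pattern;; init_search;; search_loop)"

text \<open>The bound \<open>space\<close> counts three tables of \<open>K\<close> cells,
  \<open>l\<close> scopes of two cells each and the sentinel; it ranges over all \<open>l\<close>
  with \<open>2 ^ l \<le> m\<close> because this is what \<open>length_scopes\<close> yields. The
  bounds on \<open>w\<close> cover letters, products with \<open>k\<close> and addresses.\<close>

locale search = pstring W K m + machine T P w s
  for W :: "nat \<Rightarrow> nat" and K m :: nat and T P :: "nat list" and w s :: nat +
  fixes n :: nat
  assumes length_P: "length P = m" and length_T: "length T = n"
    and P_nth: "\<And>i. i < m \<Longrightarrow> P ! i = W i"
    and T_nth: "\<And>i. i < n \<Longrightarrow> T ! i = W (m + i)"
    and m_pos: "1 \<le> m" and m_le: "m \<le> n" and K_pos: "1 \<le> K"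
    and W_less: "\<And>i. i < n + m \<Longrightarrow> W i < w"
    and word_pos: "k * (n + m + 1) < w"
    and word_addr: "3 * K + 2 * m + 4 < w"
    and space: "\<And>l. 2 ^ l \<le> m \<Longrightarrow> 3 * K + 2 * l + 2 \<le> s"
begin

section \<open>Invariants of memory and registers\<close>

definition first_tab :: "(nat \<Rightarrow> nat) \<Rightarrow> bool" where
  "first_tab M \<longleftrightarrow> (\<forall>d<m. W d < K \<longrightarrow> M (W d) = Suc (fst_occ (W d))) \<and>
    (\<forall>l<\<kappa>. M (2 * K + l) = firsts m ! l)"

definition inverse_tab :: "nat \<Rightarrow> nat \<Rightarrow> (nat \<Rightarrow> nat) \<Rightarrow> bool" where
  "inverse_tab p j M \<longleftrightarrow> (\<forall>d<j. W d < K \<and> fst_occ (W d) = d \<longrightarrow> M (K + W (p + d)) = d)"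

definition scope_tab :: "(nat \<times> nat) list \<Rightarrow> (nat \<Rightarrow> nat) \<Rightarrow> bool" where
  "scope_tab L M \<longleftrightarrow> (\<forall>l\<le>length L. M (3 * K + 2 * l) = fst ((L @ [(Suc m, m)]) ! l) \<and>
    M (3 * K + 2 * l + 1) = snd ((L @ [(Suc m, m)]) ! l))"

text \<open>The bound on the inverse table includes leftover entries: they are loaded before they
  are verified and so have to fit into a word.\<close>

definition tables :: "(nat \<times> nat) list \<Rightarrow> (nat \<Rightarrow> nat) \<Rightarrow> bool" where
  "tables L M \<longleftrightarrow> first_tab M \<and> scope_tab L M \<and> (\<forall>x<K. M (K + x) < m)"

definition registers :: "nat \<Rightarrow> nat \<Rightarrow> (nat \<times> nat) list \<Rightarrow> (nat \<Rightarrow> nat) \<Rightarrow> bool" where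
  "registers p j L R \<longleftrightarrow> R 0 = n \<and> R (Suc 0) = m \<and> R 2 = K \<and> R 4 = \<kappa> \<and> R 5 = k \<and> R 6 = p \<and> R 7 = j \<and>
    R 16 = last_reach L \<and> R 17 = 3 * K + 2 * length L"

definition aligned :: "nat \<Rightarrow> nat \<Rightarrow> bool" where
  "aligned p j \<longleftrightarrow> 1 \<le> p \<and> j \<le> m \<and> p + j \<le> n + m \<and> eqv 0 p j"

lemma word_pos': "n + m + 1 < w" "x \<le> n + m + 1 \<Longrightarrow> k * x < w"
proof -
  have "1 * (n + m + 1) \<le> k * (n + m + 1)" by (rule mult_le_mono1) (use k_ge in simp)
  then have "n + m + 1 \<le> k * (n + m + 1)" by (simp only: mult_1)
  then show "n + m + 1 < w" using word_pos by (rule le_less_trans)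
  assume "x \<le> n + m + 1"
  then have "k * x \<le> k * (n + m + 1)" by (rule mult_le_mono2)
  then show "k * x < w" using word_pos by (rule le_less_trans)
qed

lemma space': "3 * K + 2 \<le> s"
  using space[of 0] m_pos by simp

section \<open>Extending the current match\<close>

lemma wp_read_PT:
  assumes "reg st (Suc 0) = m" "r' \<noteq> 13" "reg st r' < n + m"
  shows "wp (read_PT r (Reg r')) Q st t \<longleftrightarrow>
    Q (set_reg r (W (reg st r')) (set_reg 13 (reg st r' - m) st)) (t - 3)"
  using assms word_pos'(1) W_less[of "reg st r'"] T_nth[of "reg st r' - m"] P_nth[of "reg st r'"]
  by (cases "reg st r' < m") (simp_all add: read_PT_def wp_step length_P length_T less_diff_conv2)

text \<open>If \<open>x\<close> is the image of some letter, the first occurrence of that letter has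
  the same image and is what the table holds; conversely, a verified entry is itself a
  witness.\<close>

lemma used_iff:
  assumes "first_tab M" "inverse_tab p j M" "eqv 0 p j" "j < m" "x < K"
  shows "(\<exists>d<j. W (p + d) = x) \<longleftrightarrow> M (K + x) < j \<and> W (p + M (K + x)) = x"
proof
  assume "\<exists>d<j. W (p + d) = x"
  then obtain d where d: "d < j" "W (p + d) = x" by blast
  define d' where "d' = fst_occ (W d)"
  have E: "W i < K \<longleftrightarrow> W (p + i) < K" "W i = W i' \<longleftrightarrow> W (p + i) = W (p + i')"
    if "i < j" "i' < j" for i i' using assms(3) that unfolding eqv_iff add_0 by blast+
  have d': "W d' = W d" "d' < j" using fst_occ[of d] d by (auto simp: d'_def)
  moreover have "W d < K" using E(1)[OF d(1) d(1)] d assms(5) by simp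
  moreover have "W (p + d') = x" using E(2)[OF d'(2) d(1)] d' d by simp
  ultimately have "M (K + x) = d'" using assms(2) d'_def unfolding inverse_tab_def by metis
  then show "M (K + x) < j \<and> W (p + M (K + x)) = x" using d' \<open>W (p + d') = x\<close> by simp
qed blast

text \<open>Expressed through the tables, \<open>eqv_Suc\<close> becomes the test that
  \<open>compare_letters\<close> carries out.\<close>

lemma eqv_Suc_test:
  assumes "first_tab M" "inverse_tab p j M" "eqv 0 p j" "j < m"
  shows "eqv 0 p (Suc j) \<longleftrightarrow>
    (if W j < K
     then W (p + j) < K \<and>
       (if M (W j) - 1 < j then W (p + (M (W j) - 1)) = W (p + j)
        else \<not> (M (K + W (p + j)) < j \<and> W (p + M (K + W (p + j))) = W (p + j)))
     else W j = W (p + j))"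
proof -
  have "M (W j) - 1 = fst_occ (W j)" if "W j < K"
    using assms(1,4) that unfolding first_tab_def by simp
  then show ?thesis
    unfolding eqv_Suc[OF assms(3)] using used_iff[OF assms, of "W (p + j)"] by auto
qed

lemma inverse_tab_Suc:
  assumes "inverse_tab p j M" "\<not> (W j < K \<and> fst_occ (W j) = j)"
  shows "inverse_tab p (Suc j) M"
  using assms unfolding inverse_tab_def by (auto simp: less_Suc_eq)

text \<open>As the image is new, the overwritten cell belongs to no earlier first
  occurrence.\<close>

lemma inverse_tab_Suc_upd:
  assumes "inverse_tab p j M" "\<And>d. d < j \<Longrightarrow> W (p + d) \<noteq> W (p + j)"
  shows "inverse_tab p (Suc j) (M(K + W (p + j) := j))"
  using assms unfolding inverse_tab_def by (auto simp: less_Suc_eq)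

lemma tables_upd:
  assumes "tables L M" "x < K" "d < m"
  shows "tables L (M(K + x := d))"
  using assms unfolding tables_def first_tab_def scope_tab_def by auto

lemma wp_compare_params:
  assumes R: "registers p j L (reg st)" "reg st 8 = 0" "reg st 9 = W j" "reg st 10 = W (p + j)"
    and M: "tables L (mem st)" "inverse_tab p j (mem st)"
    and al: "aligned p j" "p \<le> n" "j < m" "W j < K" "W (p + j) < K"
  shows "wp compare_params (\<lambda>st' t'. registers p j L (reg st') \<and> tables L (mem st') \<and> t - 20 \<le> t' \<and>
    (if eqv 0 p (Suc j) then reg st' 8 = 1 \<and> inverse_tab p (Suc j) (mem st')
     else reg st' 8 = 0 \<and> inverse_tab p j (mem st')) \<and> out st' = out st) st t"
proof -
  have ft: "first_tab (mem st)" and eqv: "eqv 0 p j" using M al by (auto simp: tables_def aligned_def)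
  note test = eqv_Suc_test[OF ft M(2) eqv al(3)]
  note Rs = R(1)[unfolded registers_def] R(2,3,4)
  have 1: "mem st (W j) = Suc (fst_occ (W j))" using ft al by (simp add: first_tab_def)
  have 2: "mem st (K + W (p + j)) < m" using M al by (simp add: tables_def)
  have 3: "fst_occ (W j) \<le> j" by (rule fst_occ)
  have 4: "inverse_tab p (Suc j) (mem st)" if "fst_occ (W j) < j"
    by (rule inverse_tab_Suc[OF M(2)]) (use that in simp)
  have 5: "inverse_tab p (Suc j) ((mem st)(K + W (p + j) := j))"
    if "\<not> (mem st (K + W (p + j)) < j \<and> W (p + mem st (K + W (p + j))) = W (p + j))"
    by (rule inverse_tab_Suc_upd[OF M(2)])
      (use that used_iff[OF ft M(2) eqv al(3,5)] in blast)
  note 6 = tables_upd[OF M(1) al(5,3)]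
  have 7: "fst_occ (W j) < j \<Longrightarrow> p + fst_occ (W j) < n + m"
    "mem st (K + W (p + j)) < j \<Longrightarrow> p + mem st (K + W (p + j)) < n + m"
    using al by (auto simp: aligned_def)
  have 8: "W j < s" "K + W (p + j) < s" "K + W (p + j) < w" "p + mem st (K + W (p + j)) < w" "p + fst_occ (W j) < w"
    "m < w" "mem st (K + W (p + j)) < w" "Suc 0 < w" "j < w" "0 < w"
    "fst_occ (W j) < w" "Suc (fst_occ (W j)) < w"
    using al 2 3 space' word_addr word_pos'(1) K_pos by linarith+
  show ?thesis
    unfolding compare_params_def wp_step
    using 5 6 test
    by (simp add: Rs 1 8 wp_read_PT wp_step 4 7 al registers_def M)
qed

lemma wp_extend_match:
  assumes R: "registers p j L (reg st)" and M: "tables L (mem st)" "inverse_tab p j (mem st)"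
    and al: "aligned p j" "p \<le> n" and t: "40 * (int m - int j) + 60 \<le> t"
  shows "wp extend_match (\<lambda>st' t'. \<exists>j'. registers p j' L (reg st') \<and> tables L (mem st') \<and>
    inverse_tab p j' (mem st') \<and> aligned p j' \<and> j \<le> j' \<and> (j' = m \<or> \<not> eqv 0 p (Suc j')) \<and>
    out st' = out st \<and> t - 40 * (int j' - int j) - 60 \<le> t') st t"
proof -
  \<comment> \<open>A successful step costs at most 40, charged to the longer match; the single
    failing step, which leaves the flag cleared, is charged to the constant.\<close>
  define I where "I st' t' \<longleftrightarrow> (\<exists>j'. registers p j' L (reg st') \<and> tables L (mem st') \<and>
    inverse_tab p j' (mem st') \<and> aligned p j' \<and> j \<le> j' \<and>
    (reg st' 8 = 1 \<or> reg st' 8 = 0 \<and> (j' = m \<or> \<not> eqv 0 p (Suc j'))) \<and> out st' = out st \<and>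
    t - 40 * (int j' - int j) - (if reg st' 8 = 1 then 1 else 50) \<le> t')" for st' :: state and t'
  have I_intro: "I st' t'" if "registers p j' L (reg st')" "tables L (mem st')"
    "inverse_tab p j' (mem st')" "aligned p j'" "j \<le> j'"
    "reg st' 8 = 1 \<or> reg st' 8 = 0 \<and> (j' = m \<or> \<not> eqv 0 p (Suc j'))" "out st' = out st"
    "t - 40 * (int j' - int j) - (if reg st' 8 = 1 then 1 else 50) \<le> t'" for j' st' t'
    unfolding I_def using that by blast
  have step: "reg st2 7 + reg st2 8 < w \<and> I (set_reg 7 (reg st2 7 + reg st2 8) st2) (t2 - 1)"
    if a: "registers p j' L (reg st2)" "tables L (mem st2)" "aligned p j'" "j \<le> j'" "j' < m"
      "if eqv 0 p (Suc j') then reg st2 8 = 1 \<and> inverse_tab p (Suc j') (mem st2)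
       else reg st2 8 = 0 \<and> inverse_tab p j' (mem st2)"
      "out st2 = out st" "t - 40 * (int j' - int j) - 40 \<le> t2" for j' st2 t2
  proof (cases "eqv 0 p (Suc j')")
    case True
    have "registers p (Suc j') L (reg (set_reg 7 (reg st2 7 + reg st2 8) st2))"
      using True a by (simp add: registers_def)
    moreover have "aligned p (Suc j')" using a True al by (simp add: aligned_def)
    ultimately have "I (set_reg 7 (reg st2 7 + reg st2 8) st2) (t2 - 1)"
      using True a by (intro I_intro[where j' = "Suc j'"]) simp_all
    then show ?thesis using a True word_pos'(1) by (simp add: registers_def)
  next
    case False
    have "registers p j' L (reg (set_reg 7 (reg st2 7 + reg st2 8) st2))"
      using False a by (simp add: registers_def)
    then have "I (set_reg 7 (reg st2 7 + reg st2 8) st2) (t2 - 1)"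
      using False a by (intro I_intro[where j' = j']) simp_all
    then show ?thesis using a False word_pos'(1) by (simp add: registers_def)
  qed
  show ?thesis
    unfolding extend_match_def wp_Seq wp_simps(2)
  proof (intro conjI)
    show "val st (Imm 1) < w" using word_pos'(1) by simp
    show "wp (WHILE Eq (Reg 8) (Imm 1) extend_step) (\<lambda>st' t'. \<exists>j'. registers p j' L (reg st') \<and> tables L (mem st') \<and>
    inverse_tab p j' (mem st') \<and> aligned p j' \<and> j \<le> j' \<and> (j' = m \<or> \<not> eqv 0 p (Suc j')) \<and>
    out st' = out st \<and> t - 40 * (int j' - int j) - 60 \<le> t') (set_reg 8 (val st (Imm 1)) st) (t - 1)"
    proof (rule wp_WHILE[where I = I])
      show "I (set_reg 8 (val st (Imm 1)) st) (t - 1)"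
        by (rule I_intro[where j' = j]) (use R M al in \<open>simp_all add: registers_def\<close>)
      show "0 \<le> t'" if "I st' t'" for st' t'
        using that t unfolding I_def aligned_def by (auto split: if_splits)
      show "\<exists>j'. registers p j' L (reg st') \<and> tables L (mem st') \<and>
        inverse_tab p j' (mem st') \<and> aligned p j' \<and> j \<le> j' \<and> (j' = m \<or> \<not> eqv 0 p (Suc j')) \<and>
        out st' = out st \<and> t - 40 * (int j' - int j) - 60 \<le> t' - 1"
        if "I st' t'" "\<not> holds Eq (val st' (Reg 8)) (val st' (Imm 1))" for st' t'
        using that unfolding I_def by (auto split: if_splits)
    next
      fix st' t' assume I: "I st' t'" and h: "holds Eq (val st' (Reg 8)) (val st' (Imm 1))"
      then obtain j' where 1: "registers p j' L (reg st')" "tables L (mem st')"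
          "inverse_tab p j' (mem st')" "aligned p j'" "j \<le> j'" "out st' = out st"
          "t - 40 * (int j' - int j) - 1 \<le> t'"
        unfolding I_def by auto
      note Rs = 1(1)[unfolded registers_def]
      show "wp extend_step I st' (t' - 1)"
      proof (cases "j' < m")
        case False
        then have "j' = m" using 1(4) by (simp add: aligned_def)
        have "I (set_reg 8 0 st') (t' - 4)"
          by (rule I_intro[where j' = j']) (use 1 \<open>j' = m\<close> in \<open>simp_all add: registers_def\<close>)
        then show ?thesis using Rs \<open>j' = m\<close> word_pos'(1) by (simp add: extend_step_def wp_step)
      next
        case True
        have lt: "p + j' < n + m" using al True by simp
        define st1 where "st1 = set_reg 10 (W (p + j')) (set_reg 13 (p + j' - m) (set_reg 11 (p + j')
          (set_reg 9 (W j') (set_reg 8 0 st'))))"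
        have st1: "registers p j' L (reg st1)" "reg st1 8 = 0" "reg st1 9 = W j'"
            "reg st1 10 = W (p + j')" "mem st1 = mem st'" "out st1 = out st'" "reg st1 2 = K"
          using Rs by (simp_all add: st1_def registers_def)
        have ft: "first_tab (mem st')" and eqv: "eqv 0 p j'" using 1 by (auto simp: tables_def aligned_def)
        note test = eqv_Suc_test[OF ft 1(3) eqv True]
        have "wp compare_letters (\<lambda>st2 t2. reg st2 7 + reg st2 8 < w \<and>
           I (set_reg 7 (reg st2 7 + reg st2 8) st2) (t2 - 1)) st1 (t' - 8)"
        proof (cases "W j' < K")
          case K: True
          show ?thesis
          proof (cases "W (p + j') < K")
            case K': True
            have "wp compare_params (\<lambda>st2 t2. reg st2 7 + reg st2 8 < w \<and>
              I (set_reg 7 (reg st2 7 + reg st2 8) st2) (t2 - 1)) st1 (t' - 10)"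
              apply (rule wp_mono)
               apply (rule wp_compare_params[where p = p and j = j' and L = L])
              using 1 st1 al True K K' apply simp_all[11]
              apply (elim conjE)
              apply (rule step[where j' = j'])
              using 1 st1 True by (simp_all split: if_splits)
            then show ?thesis using K K' st1 by (simp add: compare_letters_def wp_step)
          next
            case K': False
            have "\<not> eqv 0 p (Suc j')" using test K K' by simp
            then have "reg st1 7 + reg st1 8 < w \<and> I (set_reg 7 (reg st1 7 + reg st1 8) st1) (t' - 11 - 1)"
              by (intro step[where j' = j']) (use 1 st1 True in simp_all)
            then show ?thesis using K K' st1 by (simp add: compare_letters_def wp_step)
          qed
        next
          case K: False
          have inv: "inverse_tab p (Suc j') (mem st')" by (rule inverse_tab_Suc) (use 1 K in auto)
          have "reg (set_reg 8 1 st1) 7 + reg (set_reg 8 1 st1) 8 < w \<and>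
            I (set_reg 7 (reg (set_reg 8 1 st1) 7 + reg (set_reg 8 1 st1) 8) (set_reg 8 1 st1)) (t' - 11 - 1)"
            if "W j' = W (p + j')"
            by (rule step[where j' = j']) (use 1 st1 True that test K inv in \<open>simp_all add: registers_def\<close>)
          moreover have "reg st1 7 + reg st1 8 < w \<and> I (set_reg 7 (reg st1 7 + reg st1 8) st1) (t' - 11 - 1)"
            if "W j' \<noteq> W (p + j')"
            by (rule step[where j' = j']) (use 1 st1 True that test K inv in \<open>simp_all\<close>)
          ultimately show ?thesis using K st1 word_pos'(1) by (simp add: compare_letters_def wp_step)
        qed
        then have "wp compare_letters (wp (Op 7 Add (Reg 7) (Reg 8)) I) st1 (t' - 8)"
          by (rule wp_mono) (simp add: wp_simps)
        then show ?thesis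
          using Rs True lt word_pos'(1) W_less[of j'] m_le P_nth
          by (simp add: extend_step_def wp_step wp_read_PT length_P st1_def)
      qed
    qed
  qed
qed

section \<open>Reporting occurrences\<close>

definition hits :: "nat \<Rightarrow> nat set" where
  "hits p = {i. m + i < p \<and> m + i \<le> n \<and> eqv 0 (m + i) m}"

lemma hits_Suc:
  "hits (Suc p) = (if m \<le> p \<and> p \<le> n \<and> eqv 0 p m then insert (p - m) (hits p) else hits p)"
  by (auto simp: hits_def less_Suc_eq)

text \<open>A full match at a skipped position would contain the overlap with the current match,
  which \<open>no_match_skipped\<close> excludes.\<close>

lemma hits_skip:
  assumes "aligned p j" "safe_shift j d"
  shows "hits (p + d) = hits (Suc p)"
proof -
  have "\<not> eqv 0 x m" if "p < x" "x < p + d" for x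
  proof
    assume "eqv 0 x m"
    then have "eqv 0 x (p + j - x)" by (rule eqv_take) (use assms that in \<open>unfold aligned_def, linarith\<close>)
    then show False using no_match_skipped[OF _ assms(2) that] assms(1) by (simp add: aligned_def)
  qed
  then have "m + i < Suc p" if "i \<in> hits (p + d)" for i
    using that unfolding hits_def by (metis (mono_tags, lifting) mem_Collect_eq not_less_eq)
  moreover have "1 \<le> d" using assms(2) by (simp add: safe_shift_def)
  ultimately show ?thesis unfolding hits_def by fastforce
qed

lemma wp_report_match:
  assumes R: "registers p j L (reg st)" and al: "aligned p j" "p \<le> n"
    and max: "j = m \<or> \<not> eqv 0 p (Suc j)" and out: "distinct (out st)" "set (out st) = hits p"
  shows "wp report_match (\<lambda>st' t'. registers p j L (reg st') \<and> mem st' = mem st \<and>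
    distinct (out st') \<and> set (out st') = hits (Suc p) \<and> t - 5 \<le> t') st t"
proof -
  have "eqv 0 p m \<longleftrightarrow> j = m"
    using max al eqv_take[of 0 p m "Suc j"] unfolding aligned_def
    by (metis Suc_leI le_neq_implies_less)
  moreover have "p - m \<notin> hits p" if "m \<le> p" using that by (simp add: hits_def)
  moreover have "p - m < w" using al word_pos'(1) by linarith
  ultimately show ?thesis
    using R al out unfolding report_match_def registers_def
    by (simp add: wp_step hits_Suc)
qed

section \<open>Recording a scope\<close>

lemma tables_cong:
  assumes "tables L M" "\<And>x. x < 3 * K \<Longrightarrow> M' x = M x" "scope_tab L' M'"
  shows "tables L' M'"
proof -
  have "first_tab M'"
    using assms(1,2) length_firsts_le[of m] unfolding tables_def first_tab_def by simp
  then show ?thesis using assms unfolding tables_def by simp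
qed

lemma inverse_tab_cong:
  assumes "inverse_tab p j M" "eqv 0 p j" "\<And>x. x < 3 * K \<Longrightarrow> M' x = M x"
  shows "inverse_tab p j M'"
proof -
  have "W (p + d) < K" if "d < j" "W d < K" for d
    using assms(2) that unfolding eqv_iff add_0 by blast
  then have "M' (K + W (p + d)) = M (K + W (p + d))" if "d < j" "W d < K" for d
    using that by (intro assms(3)) fastforce
  then show ?thesis using assms(1) unfolding inverse_tab_def by simp
qed

lemma scope_tab_append:
  assumes "scope_tab L M"
  shows "scope_tab (L @ [(q, r)]) (M(3 * K + 2 * length L := q, Suc (3 * K + 2 * length L) := r,
    Suc (Suc (3 * K + 2 * length L)) := Suc m, Suc (Suc (Suc (3 * K + 2 * length L))) := m))"
  unfolding scope_tab_def
proof (intro allI impI)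
  fix l assume "l \<le> length (L @ [(q, r)])"
  then consider "l < length L" | "l = length L" | "l = Suc (length L)" by fastforce
  then show "(M(3 * K + 2 * length L := q, Suc (3 * K + 2 * length L) := r,
      Suc (Suc (3 * K + 2 * length L)) := Suc m, Suc (Suc (Suc (3 * K + 2 * length L))) := m)) (3 * K + 2 * l) =
      fst (((L @ [(q, r)]) @ [(Suc m, m)]) ! l) \<and>
    (M(3 * K + 2 * length L := q, Suc (3 * K + 2 * length L) := r,
      Suc (Suc (3 * K + 2 * length L)) := Suc m, Suc (Suc (Suc (3 * K + 2 * length L))) := m)) (3 * K + 2 * l + 1) =
      snd (((L @ [(q, r)]) @ [(Suc m, m)]) ! l)"
  proof cases
    case 1
    then show ?thesis using assms unfolding scope_tab_def by (simp add: nth_append)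
  qed (simp_all add: nth_append)
qed

lemma length_less:
  assumes "scopes p L"
  shows "length L < m"
  using length_scopes[OF assms m_pos] less_exp[of "length L"] by linarith

lemma wp_record_scope:
  assumes R: "registers p j L (reg st)" and M: "tables L (mem st)" "inverse_tab p j (mem st)"
    and al: "aligned p j" "p \<le> n" and max: "j = m \<or> \<not> eqv 0 p (Suc j)" and L: "scopes p L"
  shows "wp record_scope (\<lambda>st' t'. registers p j (insert_scope p j L) (reg st') \<and>
    tables (insert_scope p j L) (mem st') \<and> inverse_tab p j (mem st') \<and> out st' = out st \<and>
    t - 25 \<le> t') st t"
proof -
  define r where "r = min m (p + j)"
  note Rs = R[unfolded registers_def]
  have w: "p + j < w" "m < w" "k * p < w" "p < w" "Suc m < w" "r < w"
    using word_pos'(1) al word_pos'(2)[of p] by (auto simp: aligned_def r_def)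
  have r: "m < p + j \<Longrightarrow> r = m" "\<not> m < p + j \<Longrightarrow> r = p + j" by (auto simp: r_def)
  show ?thesis
  proof (cases "k * p \<le> r \<and> last_reach L < r")
    case True
    have eq: "insert_scope p j L = L @ [(p, r)]" using True by (simp add: insert_scope_def r_def)
    \<comment> \<open>The extended list is known to be a scope list before it is written, so the
      logarithmic bound on its length covers the cells needed.\<close>
    have "scopes (Suc p) (L @ [(p, r)])"
      using scopes_insert[OF L _ _ _ max] al eq by (simp add: aligned_def)
    from length_scopes[OF this m_pos] length_less[OF this]
    have len: "3 * K + 2 * length L + 4 \<le> s" "Suc (length L) < m"
      using space[of "Suc (length L)"] by auto
    have wlen: "3 * K + 2 * length L + 4 < w" using len word_addr by linarith
    define M' where "M' = (mem st)(3 * K + 2 * length L := p, Suc (3 * K + 2 * length L) := r,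
      Suc (Suc (3 * K + 2 * length L)) := Suc m, Suc (Suc (Suc (3 * K + 2 * length L))) := m)"
    have "scope_tab (L @ [(p, r)]) M'"
      unfolding M'_def by (rule scope_tab_append) (use M in \<open>simp add: tables_def\<close>)
    then have "tables (L @ [(p, r)]) M'" by (rule tables_cong[OF M(1), rotated]) (simp add: M'_def)
    moreover have "inverse_tab p j M'"
      by (rule inverse_tab_cong[OF M(2)]) (use al in \<open>simp_all add: M'_def aligned_def\<close>)
    ultimately have T: "tables (L @ [(p, r)]) M'" "inverse_tab p j M'" by auto
    have lr: "last_reach (L @ [(p, x)]) = x" for x by (simp add: last_reach_def)
    show ?thesis
      using T True w len wlen unfolding record_scope_def put_sentinel_def M'_def
      by (cases "m < p + j") (simp_all add: wp_step Rs eq registers_def lr r)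
  next
    case False
    then have eq: "insert_scope p j L = L" by (auto simp: insert_scope_def r_def Let_def)
    show ?thesis
      using False M w unfolding record_scope_def
      by (cases "m < p + j"; cases "k * p \<le> r") (simp_all add: wp_step Rs eq registers_def r)
  qed
qed

section \<open>Shifting the pattern and rebuilding the inverse table\<close>

lemma k_mult_leD: "k * q \<le> x \<Longrightarrow> q \<le> x"
  using k_ge mult_le_mono1[of 1 k q] by (simp only: mult_1) linarith

text \<open>Both components increase strictly along the list and hence exceed the index; this allows
  charging the scan of the list to the length of the shift.\<close>

lemma sound_scopes_nth:
  assumes "sound_scopes p L" "i < length L"
  shows "i < fst (L ! i) \<and> i < snd (L ! i)"
  using assms(2)
proof (induction i)
  case 0
  obtain q r where qr: "L ! 0 = (q, r)" by fastforce
  then have "(q, r) \<in> set L" using 0 nth_mem[of 0 L] by simp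
  from sound_scopesD(1,3)[OF assms(1) this] k_mult_leD[of q r] show ?case using qr by simp
next
  case (Suc i)
  then have "fst (L ! i) < fst (L ! Suc i) \<and> snd (L ! i) < snd (L ! Suc i)"
    using assms(1) sorted_wrt_nth_less[of _ L i "Suc i"] unfolding sound_scopes_def by fastforce
  then show ?case using Suc by fastforce
qed

lemma wp_shift:
  assumes R: "registers p j L (reg st)" and M: "tables L (mem st)"
    and al: "aligned p j" "p \<le> n" and L: "scopes (Suc p) L" and t: "20 * int m + 60 \<le> t"
  shows "wp shift (\<lambda>st' t'. \<exists>d j'. registers (p + d) j' L (reg st') \<and> mem st' = mem st \<and>
    out st' = out st \<and> aligned (p + d) j' \<and> safe_shift j d \<and> j \<le> j' + k * d \<and>
    t - 30 - 20 * (int k * int d) \<le> t') st t"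
proof -
  define Q :: "state \<Rightarrow> int \<Rightarrow> bool" where "Q = (\<lambda>st' t'. \<exists>d j'. registers (p + d) j' L (reg st') \<and> mem st' = mem st \<and>
    out st' = out st \<and> aligned (p + d) j' \<and> safe_shift j d \<and> j \<le> j' + k * d \<and>
    t - 30 - 20 * (int k * int d) \<le> t')"
  define Lx where "Lx = L @ [(Suc m, m)]"
  define I where "I st' t' \<longleftrightarrow> (\<exists>i\<le>length L. registers p j L (reg st') \<and> mem st' = mem st \<and>
    out st' = out st \<and> reg st' 3 = 3 * K + 2 * i \<and> reg st' 15 = snd (Lx ! i) \<and>
    (\<forall>i'<i. snd (Lx ! i') < j) \<and> t - 3 - 10 * int i \<le> t')" for st' :: state and t'
  have sound: "sound_scopes (Suc p) L" using L by (simp add: scopes_def)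
  have tab: "mem st (3 * K + 2 * i) = fst (Lx ! i)" "mem st (Suc (3 * K + 2 * i)) = snd (Lx ! i)"
    if "i \<le> length L" for i using M that by (auto simp: tables_def scope_tab_def Lx_def)
  have Lx_le: "fst (Lx ! i) \<le> Suc m \<and> snd (Lx ! i) \<le> m" if "i \<le> length L" for i
  proof (cases "i = length L")
    case False
    then have "i < length L" using that by simp
    moreover obtain q r where "L ! i = (q, r)" by fastforce
    ultimately have "(q, r) \<in> set L" "Lx ! i = (q, r)" by (auto simp: Lx_def nth_append in_set_conv_nth)
    then show ?thesis
      using sound_scopesD(3,4)[OF sound, of q r] k_mult_leD[of q r] by simp
  qed (simp add: Lx_def)
  have len: "length L < m" by (rule length_less[OF L])
  have addr: "3 * K + 2 * i + 1 < s" "3 * K + 2 * i + 1 < w" if "i \<le> length L" for i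
    using space[OF length_scopes[OF L m_pos]] that word_addr len by linarith+
  have w: "m < w" "Suc m < w" "k < w" using word_pos'(1) word_pos'(2)[of 1] by auto
  have finish: "wp (Load 18 (Reg 3);; Op 11 Mul (Reg 5) (Reg 18);;
     IF Le (Reg 11) (Reg 7)
       (Op 7 Sub (Reg 7) (Reg 18);; Op 6 Add (Reg 6) (Reg 18))
       (Op 11 Div (Reg 7) (Reg 5);; Op 11 Add (Reg 11) (Imm 1);; Op 6 Add (Reg 6) (Reg 11);;
        Move 7 (Imm 0))) Q st' (t' - 1)"
    if I: "I st' t'" and h: "\<not> reg st' 15 < reg st' 7" for st' t'
  proof -
    obtain i where i: "i \<le> length L" "registers p j L (reg st')" "mem st' = mem st"
      "out st' = out st" "reg st' 3 = 3 * K + 2 * i" "reg st' 15 = snd (Lx ! i)"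
      "\<And>i'. i' < i \<Longrightarrow> snd (Lx ! i') < j" "t - 3 - 10 * int i \<le> t'"
      using I unfolding I_def by blast
    note Rs = i(2)[unfolded registers_def]
    obtain q r where qr: "Lx ! i = (q, r)" by fastforce
    have jr: "j \<le> r" using h i(6) Rs qr by simp
    have qw: "q < w" "k * q < w" "q \<le> Suc m"
      using Lx_le[OF i(1)] qr w word_pos'(2)[of q] by auto
    define d where "d = (if k * q \<le> j then q else Suc (j div k))"
    define j' where "j' = (if k * q \<le> j then j - q else 0)"
    have eqv: "eqv 0 p j" "j \<le> m" "1 \<le> p" "p + j \<le> n + m" using al by (auto simp: aligned_def)
    note lookup = safe_shift_lookup[OF L eqv(3,1,2) i(1) qr[unfolded Lx_def] jr i(7)[unfolded Lx_def]]
    have safe: "safe_shift j d" using lookup(1) by (simp add: d_def)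
    \<comment> \<open>The shift pays for the scan: if \<open>d = q\<close>, the index is below
      \<open>q\<close>; otherwise the reaches passed over, all below \<open>j\<close>, number at
      most \<open>j\<close>, and \<open>j < k d\<close>.\<close>
    have id: "i \<le> k * d"
    proof (cases "k * q \<le> j")
      case True
      have "q \<le> m" using k_mult_leD[OF True] eqv by simp
      then have "i < length L" using i(1) qr by (auto simp: Lx_def nth_append split: if_splits)
      then have "i < q" using sound_scopes_nth[OF sound, of i] qr by (simp add: Lx_def nth_append)
      also have "q \<le> k * q" by (rule k_mult_leD) simp
      finally show ?thesis using True by (simp add: d_def)
    next
      case False
      show ?thesis
      proof (cases i)
        case (Suc i0)
        then have "i0 < snd (L ! i0)" "snd (L ! i0) < j"
          using sound_scopes_nth[OF sound, of i0] i(7)[of i0] i(1) by (auto simp: Lx_def nth_append)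
        then have "i \<le> j" using Suc by simp
        also have "j \<le> k * Suc (j div k)"
          using k_ge dividend_less_times_div[of k j] by simp
        finally show ?thesis using False by (simp add: d_def)
      qed simp
    qed
    \<comment> \<open>This bounds the matched letters given up; the potential of the main loop
      relies on it.\<close>
    have jd: "j \<le> j' + k * d"
    proof (cases "k * q \<le> j")
      case True
      have "q \<le> k * q" by (rule k_mult_leD) simp
      then have "j \<le> j - q + k * q" using True by linarith
      then show ?thesis using True by (simp add: d_def j'_def)
    next
      case False
      then show ?thesis using k_ge dividend_less_times_div[of k j] by (simp add: d_def j'_def)
    qed
    have al': "aligned (p + d) j'"
    proof (cases "k * q \<le> j")
      case True
      have "q \<le> j" using k_mult_leD[OF True] .
      \<comment> \<open>The prefix of length \<open>j - q\<close> matches at \<open>q\<close> within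
        the matched prefix, and the match at \<open>p\<close> carries this over to
        \<open>p + q\<close>.\<close>
      have "eqv 0 q (j - q)" using lookup(2) True by simp
      moreover have "eqv (0 + q) (p + q) (j - q)" by (rule eqv_sub[OF eqv(1)]) (use \<open>q \<le> j\<close> in simp)
      ultimately have "eqv 0 (p + q) (j - q)" using eqv_trans by simp
      then show ?thesis using True \<open>q \<le> j\<close> eqv by (simp add: aligned_def d_def j'_def)
    next
      case False
      \<comment> \<open>Since \<open>k \<ge> 4\<close>, the shift is at most \<open>m\<close>; with
        \<open>p \<le> n\<close> the new position stays within the word.\<close>
      have "4 * (j div k) \<le> k * (j div k)" using k_ge by simp
      then have "4 * (j div k) \<le> m" using eqv by (metis le_trans times_div_less_eq_dividend)
      then have "Suc (j div k) \<le> m" using m_pos by linarith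
      then show ?thesis using False al by (simp add: aligned_def d_def j'_def)
    qed
    have pd: "p + d < w" using al' word_pos'(1) by (simp add: aligned_def)
    have Q_intro: "Q st2 t2" if "registers (p + d) j' L (reg st2)" "mem st2 = mem st'" "out st2 = out st'"
      "t' - 10 \<le> t2" for st2 t2
    proof -
      have "int i \<le> int k * int d" using id by (metis of_nat_le_iff of_nat_mult)
      moreover have "0 \<le> int k * int d" by simp
      ultimately have "t - 30 - 20 * (int k * int d) \<le> t2" using that(4) i(8) by linarith
      then show ?thesis unfolding Q_def using that(1-3) i(3,4) al' safe jd by auto
    qed
    show ?thesis
    proof (cases "k * q \<le> j")
      case True
      then have d: "d = q" "j' = j - q" by (simp_all add: d_def j'_def)
      have "j - q < w" "3 * K + 2 * i < s" using eqv w addr[OF i(1)] by linarith+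
      moreover have "Q (set_reg 6 (p + q) (set_reg 7 (j - q) (set_reg 11 (k * q) (set_reg 18 q st')))) (t' - 6)"
        by (rule Q_intro) (use Rs d in \<open>simp_all add: registers_def\<close>)
      ultimately show ?thesis
        using True Rs i(3,5) tab[OF i(1)] qr qw pd d by (simp add: wp_step)
    next
      case False
      then have d: "d = Suc (j div k)" "j' = 0" by (simp_all add: d_def j'_def)
      have "j div k < w" "Suc (j div k) < w" "p + Suc (j div k) < w" "3 * K + 2 * i < s" "0 < w"
        using d pd addr[OF i(1)] by linarith+
      moreover have "Q (set_reg 7 0 (set_reg 6 (p + Suc (j div k)) (set_reg 11 (Suc (j div k))
          (set_reg 11 (j div k) (set_reg 11 (k * q) (set_reg 18 q st')))))) (t' - 8)"
        by (rule Q_intro) (use Rs d in \<open>simp_all add: registers_def\<close>)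
      ultimately show ?thesis
        using False Rs i(3,5) tab[OF i(1)] qr qw by (simp add: wp_step)
    qed
  qed
  have "wp (WHILE Lt (Reg 15) (Reg 7)
       (Op 3 Add (Reg 3) (Imm 2);; Op 11 Add (Reg 3) (Imm 1);; Load 15 (Reg 11)))
    (wp (Load 18 (Reg 3);; Op 11 Mul (Reg 5) (Reg 18);;
     IF Le (Reg 11) (Reg 7)
       (Op 7 Sub (Reg 7) (Reg 18);; Op 6 Add (Reg 6) (Reg 18))
       (Op 11 Div (Reg 7) (Reg 5);; Op 11 Add (Reg 11) (Imm 1);; Op 6 Add (Reg 6) (Reg 11);;
        Move 7 (Imm 0))) Q)
     (set_reg 15 (snd (Lx ! 0)) (set_reg 11 (Suc (3 * K)) (set_reg 3 (3 * K) st))) (t - 3)"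
  proof (rule wp_WHILE[where I = I])
    show "I (set_reg 15 (snd (Lx ! 0)) (set_reg 11 (Suc (3 * K)) (set_reg 3 (3 * K) st))) (t - 3)"
      unfolding I_def using R by (intro exI[of _ 0]) (simp add: registers_def)
    show "0 \<le> t'" if "I st' t'" for st' t'
      using that t len unfolding I_def by auto
  next
    fix st' t' assume I: "I st' t'" and h: "holds Lt (val st' (Reg 15)) (val st' (Reg 7))"
    obtain i where i: "i \<le> length L" "registers p j L (reg st')" "mem st' = mem st"
      "out st' = out st" "reg st' 3 = 3 * K + 2 * i" "reg st' 15 = snd (Lx ! i)"
      "\<And>i'. i' < i \<Longrightarrow> snd (Lx ! i') < j" "t - 3 - 10 * int i \<le> t'"
      using I unfolding I_def by blast
    have lt: "snd (Lx ! i) < j" using h i by (simp add: registers_def)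
    then have "i \<noteq> length L" using al by (auto simp: Lx_def aligned_def)
    then have i': "Suc i \<le> length L" using i by simp
    have "I (set_reg 15 (snd (Lx ! Suc i)) (set_reg 11 (Suc (3 * K + 2 * Suc i)) (set_reg 3 (3 * K + 2 * Suc i) st')))
      (t' - 4)"
      unfolding I_def using i i' lt
      by (intro exI[of _ "Suc i"]) (simp add: registers_def less_Suc_eq all_conj_distrib imp_disjL)
    then show "wp (Op 3 Add (Reg 3) (Imm 2);; Op 11 Add (Reg 3) (Imm 1);; Load 15 (Reg 11)) I st' (t' - 1)"
      using i addr[OF i'] tab[OF i'] Lx_le[OF i'] w by (simp add: wp_step)
  next
    fix st' t' assume "I st' t'" "\<not> holds Lt (val st' (Reg 15)) (val st' (Reg 7))"
    then show "wp (Load 18 (Reg 3);; Op 11 Mul (Reg 5) (Reg 18);;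
     IF Le (Reg 11) (Reg 7)
       (Op 7 Sub (Reg 7) (Reg 18);; Op 6 Add (Reg 6) (Reg 18))
       (Op 11 Div (Reg 7) (Reg 5);; Op 11 Add (Reg 11) (Imm 1);; Op 6 Add (Reg 6) (Reg 11);;
        Move 7 (Imm 0))) Q st' (t' - 1)" by (intro finish) simp_all
  qed
  then have "wp shift Q st t"
    using R addr[of 0] tab[of 0] Lx_le[of 0] w unfolding shift_def wp_Seq registers_def
    by (simp add: wp_simps)
  then show ?thesis by (simp add: Q_def)
qed

text \<open>Only the first occurrences in the pattern are visited, so the cost depends on
  \<open>\<kappa>\<close> and not on \<open>K\<close>; cells of other letters keep their old
  contents.\<close>

lemma wp_rebuild_inverse:
  assumes R: "registers p j L (reg st)" and M: "tables L (mem st)"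
    and al: "aligned p j" and t: "30 * int \<kappa> + 10 \<le> t"
  shows "wp rebuild_inverse (\<lambda>st' t'. registers p j L (reg st') \<and> tables L (mem st') \<and>
    inverse_tab p j (mem st') \<and> out st' = out st \<and> t - 30 * int \<kappa> - 10 \<le> t') st t"
proof -
  define I where "I st' t' \<longleftrightarrow> (\<exists>l\<le>\<kappa>. registers p j L (reg st') \<and> tables L (mem st') \<and>
    out st' = out st \<and> reg st' 3 = l \<and>
    (\<forall>l'<l. firsts m ! l' < j \<longrightarrow> mem st' (K + W (p + firsts m ! l')) = firsts m ! l') \<and>
    t - 2 - 20 * int l \<le> t')" for st' :: state and t'
  have eqv: "eqv 0 p j" "j \<le> m" "p + j \<le> n + m" using al by (auto simp: aligned_def)
  have E: "W d < K \<longleftrightarrow> W (p + d) < K" "W d = W d' \<longleftrightarrow> W (p + d) = W (p + d')"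
    if "d < j" "d' < j" for d d' using eqv(1) that unfolding eqv_iff add_0 by blast+
  have F: "firsts m ! l < m" "W (firsts m ! l) < K" "fst_occ (W (firsts m ! l)) = firsts m ! l"
    if "l < \<kappa>" for l using nth_mem[OF that] unfolding set_firsts by auto
  have w: "m < w" using word_pos'(1) by simp
  show ?thesis
    unfolding rebuild_inverse_def wp_Seq wp_simps(2)
  proof (intro conjI, use w in simp, rule wp_WHILE[where I = I])
    show "I (set_reg 3 (val st (Imm 0)) st) (t - 1)"
      unfolding I_def using R M by (intro exI[of _ 0]) (simp add: registers_def)
    show "0 \<le> t'" if "I st' t'" for st' t' using that t unfolding I_def by auto
    show "registers p j L (reg st') \<and> tables L (mem st') \<and>
      inverse_tab p j (mem st') \<and> out st' = out st \<and> t - 30 * int \<kappa> - 10 \<le> t' - 1"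
      if I: "I st' t'" and h: "\<not> holds Lt (val st' (Reg 3)) (val st' (Reg 4))" for st' t'
    proof -
      obtain l where l: "l \<le> \<kappa>" "registers p j L (reg st')" "tables L (mem st')"
        "out st' = out st" "reg st' 3 = l" "t - 2 - 20 * int l \<le> t'"
        "\<And>l'. l' < l \<Longrightarrow> firsts m ! l' < j \<Longrightarrow> mem st' (K + W (p + firsts m ! l')) = firsts m ! l'"
        using I unfolding I_def by blast
      have "l = \<kappa>" using l h by (simp add: registers_def)
      have "mem st' (K + W (p + d)) = d" if d: "d < j" "W d < K" "fst_occ (W d) = d" for d
      proof -
        have "d \<in> set (firsts m)" using d eqv by (simp add: set_firsts)
        then obtain l' where "l' < \<kappa>" "firsts m ! l' = d" by (meson in_set_conv_nth)
        then show ?thesis using l(7)[of l'] \<open>l = \<kappa>\<close> d by simp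
      qed
      then have "inverse_tab p j (mem st')" by (simp add: inverse_tab_def)
      then show ?thesis using l \<open>l = \<kappa>\<close> by simp
    qed
  next
    fix st' :: state and t' :: int assume I: "I st' t'" and h: "holds Lt (val st' (Reg 3)) (val st' (Reg 4))"
    obtain l where l: "l \<le> \<kappa>" "registers p j L (reg st')" "tables L (mem st')"
      "out st' = out st" "reg st' 3 = l" "t - 2 - 20 * int l \<le> t'"
      "\<And>l'. l' < l \<Longrightarrow> firsts m ! l' < j \<Longrightarrow> mem st' (K + W (p + firsts m ! l')) = firsts m ! l'"
      using I unfolding I_def by blast
    have lt: "l < \<kappa>" using l h by (simp add: registers_def)
    note Rs = l(2)[unfolded registers_def]
    define d where "d = firsts m ! l"
    have d: "d < m" "W d < K" "fst_occ (W d) = d" using F[OF lt] by (simp_all add: d_def)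
    have md: "mem st' (2 * K + l) = d" using l(3) lt by (simp add: tables_def first_tab_def d_def)
    have a: "2 * K + l < s" "2 * K + l < w" "2 * K < w" "Suc l < w" "d < w"
      using lt length_firsts_le[of m] space' word_addr d w by linarith+
    show "wp (Op 11 Mul (Imm 2) (Reg 2);; Op 11 Add (Reg 11) (Reg 3);; Load 14 (Reg 11);;
     IF Lt (Reg 14) (Reg 7) (
       Op 11 Add (Reg 6) (Reg 14);; read_PT 10 (Reg 11);;
       Op 10 Add (Reg 10) (Reg 2);; Store (Reg 10) (Reg 14)) Skip;;
     Op 3 Add (Reg 3) (Imm 1)) I st' (t' - 1)"
    proof (cases "d < j")
      case False
      have "I (set_reg 3 (Suc l) (set_reg 14 d (set_reg 11 (2 * K + l) (set_reg 11 (2 * K) st')))) (t' - 7)"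
        unfolding I_def using l lt False
        by (intro exI[of _ "Suc l"]) (simp add: registers_def less_Suc_eq all_conj_distrib imp_disjL d_def)
      then show ?thesis using False Rs l(5) md a by (simp add: wp_step)
    next
      case True
      have pd: "p + d < n + m" "p + d < w" using True eqv word_pos'(1) by linarith+
      have WK: "W (p + d) < K" using E(1)[OF True True] d by simp
      have a': "K + W (p + d) < s" "K + W (p + d) < w" using WK space' word_addr by linarith+
      \<comment> \<open>Different first occurrences carry different letters and hence have different
        images, so this write spares the entries made in earlier rounds.\<close>
      have new: "firsts m ! l' < j \<longrightarrow>
          ((mem st')(K + W (p + d) := d)) (K + W (p + firsts m ! l')) = firsts m ! l'" if "l' < Suc l" for l'
      proof (cases "l' = l")
        case False
        then have "l' < l" "l' < \<kappa>" using that lt by auto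
        have "W (firsts m ! l') \<noteq> W d"
        proof
          assume "W (firsts m ! l') = W d"
          then have "firsts m ! l' = firsts m ! l" using F(3)[OF \<open>l' < \<kappa>\<close>] d(3) by (simp add: d_def)
          moreover have "distinct (firsts m)" by (simp add: firsts_def)
          ultimately show False using False lt \<open>l' < \<kappa>\<close> nth_eq_iff_index_eq by blast
        qed
        then show ?thesis using E(2)[OF _ True, of "firsts m ! l'"] l(7)[OF \<open>l' < l\<close>] by auto
      qed (simp add: d_def)
      have "I (set_reg 3 (Suc l) (set_mem (K + W (p + d)) d (set_reg 10 (W (p + d) + K)
          (set_reg 10 (W (p + d)) (set_reg 13 (p + d - m) (set_reg 11 (p + d)
          (set_reg 14 d (set_reg 11 (2 * K + l) (set_reg 11 (2 * K) st'))))))))) (t' - 12)"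
        unfolding I_def using l lt new tables_upd[OF l(3) WK d(1)]
        by (intro exI[of _ "Suc l"]) (simp add: registers_def)
      then show ?thesis using True Rs l(5) md a a' pd
        by (simp add: wp_step wp_read_PT add.commute[of "W (p + d)" K])
    qed
  qed
qed

section \<open>The main loop and its potential\<close>

lemma wp_search_loop:
  assumes R: "registers p j L (reg st)" and M: "tables L (mem st)" "inverse_tab p j (mem st)"
    and al: "aligned p j" and L: "scopes p L" and out: "distinct (out st)" "set (out st) = hits p"
    and t: "100 * (2 * (int k * (int n + int m - int p)) + (int m - int j)) + 10 \<le> t"
  shows "wp search_loop (\<lambda>st' t'. distinct (out st') \<and>
    set (out st') = {i. m + i \<le> n \<and> eqv 0 (m + i) m} \<and> 0 \<le> t') st t"
proof -
  \<comment> \<open>The budget carries the potential: each unit of shift releases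
    \<open>200 k\<close>, each newly matched letter 100.\<close>
  define I where "I st' t' \<longleftrightarrow> (\<exists>p j L. registers p j L (reg st') \<and> tables L (mem st') \<and>
    inverse_tab p j (mem st') \<and> aligned p j \<and> scopes p L \<and> distinct (out st') \<and>
    set (out st') = hits p \<and>
    100 * (2 * (int k * (int n + int m - int p)) + (int m - int j)) + 10 \<le> t')" for st' :: state and t'
  have budget: "10 \<le> t'" if "aligned p j"
    "100 * (2 * (int k * (int n + int m - int p)) + (int m - int j)) + 10 \<le> t'" for p j t'
  proof -
    have "0 \<le> 100 * (2 * (int k * (int n + int m - int p)) + (int m - int j))"
      using that(1) by (intro mult_nonneg_nonneg add_nonneg_nonneg) (auto simp: aligned_def)
    then have "10 \<le> 100 * (2 * (int k * (int n + int m - int p)) + (int m - int j)) + 10"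
      by (rule add_increasing) simp
    then show ?thesis using that(2) by (rule order_trans)
  qed
  show ?thesis
    unfolding search_loop_def
  proof (rule wp_WHILE[where I = I])
    show "I st t" unfolding I_def using assms by blast
  next
    fix st' :: state and t' :: int assume "I st' t'"
    then obtain p j where "aligned p j"
      "100 * (2 * (int k * (int n + int m - int p)) + (int m - int j)) + 10 \<le> t'"
      unfolding I_def by blast
    then show "0 \<le> t'" using budget by fastforce
  next
    fix st' :: state and t' :: int assume I: "I st' t'" and h: "\<not> holds Le (val st' (Reg 6)) (val st' (Reg 0))"
    then obtain p j L where 1: "registers p j L (reg st')" "aligned p j" "distinct (out st')"
      "set (out st') = hits p"
      "100 * (2 * (int k * (int n + int m - int p)) + (int m - int j)) + 10 \<le> t'"
      unfolding I_def by blast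
    have "n < p" using h 1 by (simp add: registers_def)
    then have "hits p = {i. m + i \<le> n \<and> eqv 0 (m + i) m}" by (auto simp: hits_def)
    then show "distinct (out st') \<and>
        set (out st') = {i. m + i \<le> n \<and> eqv 0 (m + i) m} \<and> 0 \<le> t' - 1"
      using 1 budget[OF 1(2,5)] by simp
  next
    fix st0 :: state and t0 :: int assume I: "I st0 t0" and h: "holds Le (val st0 (Reg 6)) (val st0 (Reg 0))"
    then obtain p j L where 1: "registers p j L (reg st0)" "tables L (mem st0)"
      "inverse_tab p j (mem st0)" "aligned p j" "scopes p L" "distinct (out st0)"
      "set (out st0) = hits p"
      "100 * (2 * (int k * (int n + int m - int p)) + (int m - int j)) + 10 \<le> t0"
      unfolding I_def by blast
    have pn: "p \<le> n" using h 1 by (simp add: registers_def)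
    have p1: "1 \<le> p" and jm: "int j \<le> int m" using 1 by (auto simp: aligned_def)
    define V where "V = int k * (int n + int m - int p)"
    \<comment> \<open>While \<open>p \<le> n\<close>, a length of at least \<open>m\<close> remains,
      so the potential also covers the budgets linear in \<open>m\<close> that extending and
      shifting require in advance.\<close>
    have kV: "4 * int m \<le> V"
      unfolding V_def using k_ge pn by (intro mult_mono) auto
    have k4: "4 \<le> int k" "int \<kappa> \<le> int k" by (simp_all add: k_def)
    have m1: "1 \<le> int m" using m_pos by simp
    have t0: "100 * (2 * V + (int m - int j)) + 10 \<le> t0" using 1(8) unfolding V_def .
    show "wp (extend_match;; report_match;; record_scope;; shift;; rebuild_inverse) I st0 (t0 - 1)"
      unfolding wp_Seq
    proof (rule wp_mono[OF wp_extend_match[OF 1(1-4) pn]])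
      show "40 * (int m - int j) + 60 \<le> t0 - 1" using t0 kV m1 jm by (simp add: algebra_simps)
    next
      fix st1 :: state and t1 :: int assume "\<exists>j'. registers p j' L (reg st1) \<and> tables L (mem st1) \<and>
        inverse_tab p j' (mem st1) \<and> aligned p j' \<and> j \<le> j' \<and> (j' = m \<or> \<not> eqv 0 p (Suc j')) \<and>
        out st1 = out st0 \<and> t0 - 1 - 40 * (int j' - int j) - 60 \<le> t1"
      then obtain j1 where 2: "registers p j1 L (reg st1)" "tables L (mem st1)"
        "inverse_tab p j1 (mem st1)" "aligned p j1" "j \<le> j1" "j1 = m \<or> \<not> eqv 0 p (Suc j1)"
        "out st1 = out st0" "t0 - 1 - 40 * (int j1 - int j) - 60 \<le> t1"
        by blast
      have j1m: "j1 \<le> m" and eqv1: "eqv 0 p j1" using 2 by (auto simp: aligned_def)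
      have j1: "int j1 \<le> int m" "int j \<le> int j1" using j1m 2(5) by simp_all
      define L' where "L' = insert_scope p j1 L"
      have L': "scopes (Suc p) L'"
        unfolding L'_def by (rule scopes_insert[OF 1(5) p1 eqv1 j1m 2(6)])
      show "wp report_match (wp record_scope (wp shift (wp rebuild_inverse I))) st1 t1"
      proof (rule wp_mono[OF wp_report_match[OF 2(1,4) pn 2(6)]])
        show "distinct (out st1)" "set (out st1) = hits p" using 1 2 by simp_all
      next
        fix st2 :: state and t2 :: int assume 3: "registers p j1 L (reg st2) \<and> mem st2 = mem st1 \<and>
          distinct (out st2) \<and> set (out st2) = hits (Suc p) \<and> t1 - 5 \<le> t2"
        show "wp record_scope (wp shift (wp rebuild_inverse I)) st2 t2"
        proof (rule wp_mono[OF wp_record_scope[OF _ _ _ 2(4) pn 2(6) 1(5)]])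
          show "registers p j1 L (reg st2)" "tables L (mem st2)" "inverse_tab p j1 (mem st2)"
            using 2 3 by simp_all
        next
          fix st3 :: state and t3 :: int assume "registers p j1 (insert_scope p j1 L) (reg st3) \<and>
            tables (insert_scope p j1 L) (mem st3) \<and> inverse_tab p j1 (mem st3) \<and>
            out st3 = out st2 \<and> t2 - 25 \<le> t3"
          then have 4: "registers p j1 L' (reg st3)" "tables L' (mem st3)" "out st3 = out st2"
            "t2 - 25 \<le> t3" by (auto simp: L'_def)
          have t3: "200 * V + 100 * (int m - int j1) + 60 * (int j1 - int j) - 81 \<le> t3"
            using t0 2(8) conjunct2[OF conjunct2[OF conjunct2[OF conjunct2[OF 3]]]] 4(4)
            by (simp add: algebra_simps)
          show "wp shift (wp rebuild_inverse I) st3 t3"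
          proof (rule wp_mono[OF wp_shift[OF 4(1,2) 2(4) pn L']])
            show "20 * int m + 60 \<le> t3" using t3 kV m1 j1 by (simp add: algebra_simps)
          next
            fix st4 :: state and t4 :: int assume "\<exists>d j'. registers (p + d) j' L' (reg st4) \<and> mem st4 = mem st3 \<and>
              out st4 = out st3 \<and> aligned (p + d) j' \<and> safe_shift j1 d \<and> j1 \<le> j' + k * d \<and>
              t3 - 30 - 20 * (int k * int d) \<le> t4"
            then obtain d j2 where 5: "registers (p + d) j2 L' (reg st4)" "mem st4 = mem st3"
              "out st4 = out st3" "aligned (p + d) j2" "safe_shift j1 d" "j1 \<le> j2 + k * d"
              "t3 - 30 - 20 * (int k * int d) \<le> t4" by blast
            define D where "D = int k * int d"
            have "int k * 1 \<le> int k * int d"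
              using 5(5) by (intro mult_left_mono) (auto simp: safe_shift_def)
            then have kD: "int k \<le> D" by (simp add: D_def)
            have VD: "int k * (int n + int m - int (p + d)) = V - D"
              by (simp add: V_def D_def algebra_simps)
            have VD0: "0 \<le> V - D"
              unfolding VD[symmetric] using 5(4) by (simp add: aligned_def)
            have j2: "int j1 - int j2 \<le> D" using 5(6) unfolding D_def
              by (metis diff_le_eq add.commute of_nat_add of_nat_le_iff of_nat_mult)
            have t4: "200 * V + 100 * (int m - int j1) - 111 - 20 * D \<le> t4"
              using t3 5(7) j1 unfolding D_def by (simp add: algebra_simps)
            show "wp rebuild_inverse I st4 t4"
            proof (rule wp_mono[OF wp_rebuild_inverse[OF 5(1) _ 5(4)]])
              show "tables L' (mem st4)" using 4 5 by simp
              show "30 * int \<kappa> + 10 \<le> t4" using t4 VD0 kD k4 j1 by (simp add: algebra_simps)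
            next
              fix st5 :: state and t5 :: int assume 6: "registers (p + d) j2 L' (reg st5) \<and> tables L' (mem st5) \<and>
                inverse_tab (p + d) j2 (mem st5) \<and> out st5 = out st4 \<and>
                t4 - 30 * int \<kappa> - 10 \<le> t5"
              have "scopes (p + d) L'" by (rule scopes_skip[OF L' p1 eqv1 5(5)])
              moreover have "hits (p + d) = hits (Suc p)" by (rule hits_skip[OF 2(4) 5(5)])
              moreover have "t4 - 30 * int \<kappa> - 10 \<le> t5" using 6 by simp
              \<comment> \<open>Of the \<open>200 D\<close> released, at most \<open>100 D\<close>
                restores the potential of the letters given up and \<open>20 D\<close> pays for the
                scan. The remaining \<open>80 D\<close>, with \<open>D \<ge> \<kappa> + 4\<close>,
                pays for the rebuilding and the fixed costs.\<close>
              then have "100 * (2 * (V - D) + (int m - int j2)) + 10 \<le> t5"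
                using t4 kD k4 j2 by (simp add: algebra_simps)
              ultimately show "I st5 t5"
                unfolding I_def using 3 4 5 6 unfolding VD[symmetric]
                  by (rule_tac exI[of _ "p + d"], rule_tac exI[of _ j2], rule_tac exI[of _ L']) simp
            qed
          qed
        qed
      qed
    qed
  qed
qed

section \<open>Preprocessing and the whole program\<close>

lemma firsts_Suc:
  "firsts (Suc i) = firsts i @ (if W i < K \<and> (\<forall>d<i. W d \<noteq> W i) then [i] else [])"
  using fst_occ(3)[of i] by (simp add: firsts_def)

lemma wp_scan_pattern:
  assumes R: "reg st 0 = n" "reg st (Suc 0) = m" "reg st 2 = K" "reg st 3 = 0" "reg st 4 = 0"
    and M: "\<And>x. mem st x = 0" and t: "40 * int m + 10 \<le> t"
  shows "wp scan_pattern (\<lambda>st' t'. reg st' 0 = n \<and> reg st' (Suc 0) = m \<and> reg st' 2 = K \<and>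
    reg st' 4 = \<kappa> \<and> first_tab (mem st') \<and> (\<forall>x<K. mem st' (K + x) < m) \<and> out st' = out st \<and>
    t - 40 * int m - 10 \<le> t') st t"
proof -
  \<comment> \<open>The inverse table is still zero here, which satisfies the bound \<open>m\<close>
    on its entries since \<open>m \<ge> 1\<close>.\<close>
  define I where "I st' t' \<longleftrightarrow> (\<exists>i\<le>m. reg st' 0 = n \<and> reg st' (Suc 0) = m \<and> reg st' 2 = K \<and>
    reg st' 3 = i \<and> reg st' 4 = length (firsts i) \<and>
    (\<forall>x<K. mem st' x = (if \<exists>d<i. W d = x then Suc (fst_occ x) else 0)) \<and>
    (\<forall>l<length (firsts i). mem st' (2 * K + l) = firsts i ! l) \<and>
    (\<forall>x<K. mem st' (K + x) = 0) \<and> out st' = out st \<and> t - 2 - 20 * int i \<le> t')"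
    for st' :: state and t'
  show ?thesis
    unfolding scan_pattern_def
  proof (rule wp_WHILE[where I = I])
    show "I st t" unfolding I_def using R M by (intro exI[of _ 0]) (simp add: firsts_def)
    show "0 \<le> t'" if "I st' t'" for st' t' using that t unfolding I_def by auto
  next
    fix st' :: state and t' :: int assume I: "I st' t'" and h: "\<not> holds Lt (val st' (Reg 3)) (val st' (Reg 1))"
    then obtain i where i: "i \<le> m" "reg st' 0 = n" "reg st' (Suc 0) = m" "reg st' 2 = K"
      "reg st' 3 = i" "reg st' 4 = length (firsts i)"
      "\<forall>x<K. mem st' x = (if \<exists>d<i. W d = x then Suc (fst_occ x) else 0)"
      "\<forall>l<length (firsts i). mem st' (2 * K + l) = firsts i ! l"
      "\<forall>x<K. mem st' (K + x) = 0" "out st' = out st" "t - 2 - 20 * int i \<le> t'"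
      unfolding I_def by blast
    have "i = m" using i h by simp
    have "first_tab (mem st')"
      unfolding first_tab_def using i(7,8) \<open>i = m\<close> by auto
    then show "reg st' 0 = n \<and> reg st' (Suc 0) = m \<and> reg st' 2 = K \<and>
      reg st' 4 = \<kappa> \<and> first_tab (mem st') \<and> (\<forall>x<K. mem st' (K + x) < m) \<and> out st' = out st \<and>
      t - 40 * int m - 10 \<le> t' - 1"
      using i \<open>i = m\<close> m_pos by simp
  next
    fix st' :: state and t' :: int assume I: "I st' t'" and h: "holds Lt (val st' (Reg 3)) (val st' (Reg 1))"
    then obtain i where i: "i \<le> m" "reg st' 0 = n" "reg st' (Suc 0) = m" "reg st' 2 = K"
      "reg st' 3 = i" "reg st' 4 = length (firsts i)"
      "\<forall>x<K. mem st' x = (if \<exists>d<i. W d = x then Suc (fst_occ x) else 0)"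
      "\<forall>l<length (firsts i). mem st' (2 * K + l) = firsts i ! l"
      "\<forall>x<K. mem st' (K + x) = 0" "out st' = out st" "t - 2 - 20 * int i \<le> t'"
      unfolding I_def by blast
    have lt: "i < m" using i h by simp
    have len: "length (firsts i) \<le> K" "length (firsts (Suc i)) \<le> K" by (rule length_firsts_le)+
    have w: "W i < w" "Suc i < w" "0 < w" "2 * K < w" "2 * K + length (firsts i) < w"
      "2 * K + length (firsts i) < s" "Suc (length (firsts i)) < w" "m < w"
      using W_less[of i] lt word_pos'(1) word_addr len space' K_pos by linarith+
    have Ws: "W i < s" if "W i < K" using that space' by linarith
    show "wp (ReadP 9 (Reg 3);;
     IF Lt (Reg 9) (Reg 2) (
       Load 11 (Reg 9);;
       IF Eq (Reg 11) (Imm 0) (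
         Op 11 Add (Reg 3) (Imm 1);; Store (Reg 9) (Reg 11);;
         Op 11 Mul (Imm 2) (Reg 2);; Op 11 Add (Reg 11) (Reg 4);; Store (Reg 11) (Reg 3);;
         Op 4 Add (Reg 4) (Imm 1)) Skip) Skip;;
     Op 3 Add (Reg 3) (Imm 1)) I st' (t' - 1)"
    proof (cases "W i < K")
      case False
      have fs: "firsts (Suc i) = firsts i" using False by (simp add: firsts_Suc)
      have "(\<exists>d<Suc i. W d = x) \<longleftrightarrow> (\<exists>d<i. W d = x)" if "x < K" for x
        using False that by (auto simp: less_Suc_eq)
      then have "I (set_reg 3 (Suc i) (set_reg 9 (W i) st')) (t' - 5)"
        unfolding I_def using i lt fs by (intro exI[of _ "Suc i"]) simp
      then show ?thesis using False i(2-6) w lt by (simp add: wp_step length_P P_nth)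
    next
      case K: True
      show ?thesis
      proof (cases "\<exists>d<i. W d = W i")
        case True
        then have mi: "mem st' (W i) = Suc (fst_occ (W i))" using i(7) K by simp
        have fw: "Suc (fst_occ (W i)) < w" using fst_occ(2)[of i] w by simp
        have fs: "firsts (Suc i) = firsts i" using True by (auto simp: firsts_Suc)
        have "(\<exists>d<Suc i. W d = x) \<longleftrightarrow> (\<exists>d<i. W d = x)" for x
          using True by (auto simp: less_Suc_eq)
        then have "I (set_reg 3 (Suc i) (set_reg 11 (Suc (fst_occ (W i))) (set_reg 9 (W i) st'))) (t' - 7)"
          unfolding I_def using i lt fs by (intro exI[of _ "Suc i"]) simp
        then show ?thesis using K i(2-6) w lt mi fw Ws by (simp add: wp_step length_P P_nth)
      next
        case False
        then have mi: "mem st' (W i) = 0" using i(7) K by simp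
        have fs: "firsts (Suc i) = firsts i @ [i]" using False K by (auto simp: firsts_Suc)
        have fi: "fst_occ (W i) = i" using fst_occ(3)[of i] False by blast
        have len': "length (firsts i) < K" using len(2) fs by simp
        define M' where "M' = (mem st')(W i := Suc i, 2 * K + length (firsts i) := i)"
        have "M' x = (if \<exists>d<Suc i. W d = x then Suc (fst_occ x) else 0)" if "x < K" for x
          using i(7) that fi by (auto simp: M'_def less_Suc_eq)
        moreover have "M' (2 * K + l) = firsts (Suc i) ! l" if "l < length (firsts (Suc i))" for l
          using i(8) that fs K by (auto simp: M'_def nth_append less_Suc_eq)
        moreover have "M' (K + x) = 0" if "x < K" for x
          using i(9) that K by (auto simp: M'_def)
        ultimately have "I (set_reg 3 (Suc i) (set_reg 4 (Suc (length (firsts i)))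
            (set_mem (2 * K + length (firsts i)) i (set_reg 11 (2 * K + length (firsts i))
            (set_reg 11 (2 * K) (set_mem (W i) (Suc i) (set_reg 11 (Suc i) (set_reg 11 0
            (set_reg 9 (W i) st'))))))))) (t' - 12)"
          unfolding I_def using i lt fs by (intro exI[of _ "Suc i"]) (simp add: M'_def)
        then show ?thesis using K i(2-6) w lt mi Ws by (simp add: wp_step length_P P_nth)
      qed
    qed
  qed
qed

lemma wp_p_search:
  assumes t: "240 * int m + 200 * (int k * (int n + int m)) + 60 \<le> t"
  shows "wp p_search (\<lambda>st' t'. distinct (out st') \<and>
    set (out st') = {i. m + i \<le> n \<and> eqv 0 (m + i) m} \<and> 0 \<le> t') (init_state n m K) t"
proof -
  have r: "reg (init_state n m K) 0 = n" "reg (init_state n m K) (Suc 0) = m"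
    "reg (init_state n m K) 2 = K" "reg (init_state n m K) 3 = 0" "reg (init_state n m K) 4 = 0"
    "\<And>x. mem (init_state n m K) x = 0" "out (init_state n m K) = []"
    by (simp_all add: init_state_def)
  define V where "V = int k * (int n + int m)"
  have V: "0 \<le> V" "240 * int m + 200 * V + 60 \<le> t" using t by (simp_all add: V_def)
  have V1: "int k * (int n + int m - int 1) \<le> V"
    unfolding V_def by (intro mult_left_mono) auto
  have "wp (scan_pattern;; init_search;; search_loop) (\<lambda>st' t'. distinct (out st') \<and>
    set (out st') = {i. m + i \<le> n \<and> eqv 0 (m + i) m} \<and> 0 \<le> t') (init_state n m K) (t - 1)"
    unfolding wp_Seq
  proof (rule wp_mono[OF wp_scan_pattern[OF r(1-6)]])
    show "40 * int m + 10 \<le> t - 1" using V by (simp add: algebra_simps)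
  next
    fix st' :: state and t' :: int assume 1: "reg st' 0 = n \<and> reg st' (Suc 0) = m \<and> reg st' 2 = K \<and>
      reg st' 4 = \<kappa> \<and> first_tab (mem st') \<and> (\<forall>x<K. mem st' (K + x) < m) \<and>
      out st' = out (init_state n m K) \<and> t - 1 - 40 * int m - 10 \<le> t'"
    have w: "3 * K + 1 < w" "3 * K + 1 < s" "Suc m < w" "\<kappa> + 4 < w" "0 < w" "Suc 0 < w"
      using word_addr space' word_pos'(1) word_pos'(2)[of 1] m_pos by (auto simp: k_def)
    define M' where "M' = (mem st')(3 * K := Suc m, Suc (3 * K) := m)"
    have "scope_tab [] M'" by (simp add: scope_tab_def M'_def)
    moreover have "first_tab M'"
      using 1 length_firsts_le[of m] by (auto simp: first_tab_def M'_def)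
    moreover have "\<forall>x<K. M' (K + x) < m" using 1 by (auto simp: M'_def)
    ultimately have T: "tables [] M'" by (simp add: tables_def)
    \<comment> \<open>The search starts at position 1, as position 0 matches trivially and yields no
      period. The 9 is the number of instructions of \<open>init_search\<close>.\<close>
    have step: "wp search_loop (\<lambda>st' t'. distinct (out st') \<and>
      set (out st') = {i. m + i \<le> n \<and> eqv 0 (m + i) m} \<and> 0 \<le> t') st2 (t' - 9)"
      if "registers 1 0 [] (reg st2)" "mem st2 = M'" "out st2 = []" for st2
    proof (rule wp_search_loop[OF that(1)])
      show "aligned 1 0" using m_pos by (simp add: aligned_def)
      have "100 * (2 * (int k * (int n + int m - int 1)) + (int m - int 0)) + 10 \<le>
          100 * (2 * V + (int m - int 0)) + 10"
        using V1 by (intro add_mono mult_left_mono) auto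
      also have "t - 1 - 40 * int m - 10 \<le> t'" using 1 by simp
      then have "100 * (2 * V + (int m - int 0)) + 10 \<le> t' - 9" using V by (simp add: algebra_simps)
      finally show "100 * (2 * (int k * (int n + int m - int 1)) + (int m - int 0)) + 10 \<le> t' - 9" .
      show "set (out st2) = hits 1" using that(3) m_pos by (simp add: hits_def)
    qed (use that T scopes_Nil in \<open>simp_all add: inverse_tab_def\<close>)
    show "wp init_search (wp search_loop (\<lambda>st' t'. distinct (out st') \<and>
      set (out st') = {i. m + i \<le> n \<and> eqv 0 (m + i) m} \<and> 0 \<le> t')) st' t'"
      unfolding init_search_def put_sentinel_def wp_Seq using 1 w r(7)
      by (simp add: wp_simps, intro step) (simp_all add: registers_def M'_def k_def last_reach_def)
  qed
  then show ?thesis unfolding p_search_def using r m_le by (simp add: wp_IF)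
qed

end

section \<open>Letters, positions and resource bounds\<close>

lemma p_match_iff:
  assumes "finite Par" "length x = length y"
  shows "p_match Par x y \<longleftrightarrow> (\<forall>i<length y. (x ! i \<in> Par \<longleftrightarrow> y ! i \<in> Par) \<and>
    (x ! i \<notin> Par \<longrightarrow> x ! i = y ! i) \<and> (\<forall>i'<length y. x ! i = x ! i' \<longleftrightarrow> y ! i = y ! i'))"
proof -
  have "map f x = y \<longleftrightarrow> (\<forall>i\<in>{..<length y}. f (x ! i) = y ! i)" for f
    using assms(2) by (auto simp: list_eq_iff_nth_eq)
  then show ?thesis
    unfolding p_match_def using ex_permutes_iff[OF assms(1), of "{..<length y}" "(!) x" "(!) y"]
    by (simp only: Ball_def lessThan_iff)
qed

text \<open>The bound \<open>3 b + 4\<close> is for letters and addresses, \<open>2 b b\<close> for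
  products with \<open>k\<close>; together they make the fourth power a sufficient word
  range.\<close>

lemma fourth_power_bounds:
  fixes b :: nat
  assumes "3 \<le> b"
  shows "3 * b + 4 < b ^ 4" "2 * b * b < b ^ 4"
proof -
  have 1: "3 * b \<le> b * b" by (rule mult_le_mono1[OF assms])
  have "9 * (b * b) \<le> (b * b) * (b * b)"
    using mult_le_mono[OF assms assms] by (intro mult_le_mono1) simp
  then have 2: "9 * (b * b) \<le> b ^ 4" by (simp add: power4_eq_xxxx mult.assoc)
  show "3 * b + 4 < b ^ 4" "2 * b * b < b ^ 4" using 1 2 assms by linarith+
qed

locale coding =
  fixes Sig Par :: "'a set" and code :: "'a \<Rightarrow> nat" and T P :: "'a list"
  assumes finite_alphabets: "finite Sig" "finite Par"
    and letter_coding: "letter_coding Sig Par code"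
    and T: "T \<in> lists (Sig \<union> Par)" and P: "P \<in> lists (Sig \<union> Par)"
    and params: "params Par P \<noteq> {}"
begin

abbreviation "n \<equiv> length T"
abbreviation "m \<equiv> length P"
abbreviation "K \<equiv> card Par"
abbreviation "base \<equiv> n + m + card Sig + K"

definition W :: "nat \<Rightarrow> nat" where
  "W i = (map code P @ map code T) ! i"

lemma W_eq: "i < m \<Longrightarrow> W i = code (P ! i)" "i < n \<Longrightarrow> W (m + i) = code (T ! i)"
  by (simp_all add: W_def nth_append)

lemma code_Par: "x \<in> Par \<Longrightarrow> code x < K"
  using letter_coding unfolding letter_coding_def bij_betw_def by auto

lemma code_Sig: "x \<in> Sig \<Longrightarrow> K \<le> code x \<and> code x < K + card Sig"
  using letter_coding unfolding letter_coding_def bij_betw_def by auto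

lemma code_less_iff: "x \<in> Sig \<union> Par \<Longrightarrow> code x < K \<longleftrightarrow> x \<in> Par"
  using code_Par code_Sig by fastforce

lemma code_eq_iff: "x \<in> Sig \<union> Par \<Longrightarrow> y \<in> Sig \<union> Par \<Longrightarrow> code x = code y \<longleftrightarrow> x = y"
proof -
  have "inj_on code Par" "inj_on code Sig"
    using letter_coding unfolding letter_coding_def bij_betw_def by auto
  then show "x \<in> Sig \<union> Par \<Longrightarrow> y \<in> Sig \<union> Par \<Longrightarrow> code x = code y \<longleftrightarrow> x = y"
    using code_Par code_Sig by (metis Un_iff inj_on_eq_iff linorder_not_less)
qed

lemma nth_in: "i < m \<Longrightarrow> P ! i \<in> Sig \<union> Par" "i < n \<Longrightarrow> T ! i \<in> Sig \<union> Par"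
  using T P by (auto simp: in_lists_conv_set)

lemma m_pos: "1 \<le> m"
  using params by (cases P) (auto simp: params_def)

lemma K_pos: "1 \<le> K"
  using params finite_alphabets by (auto simp: params_def Suc_le_eq card_gt_0_iff)

lemma W_less: "i < n + m \<Longrightarrow> W i < base"
proof -
  assume i: "i < n + m"
  obtain x where "x \<in> Sig \<union> Par" "W i = code x"
  proof (cases "i < m")
    case True then show ?thesis using that nth_in(1) W_eq(1) by blast
  next
    case False
    then have "i - m < n" "m + (i - m) = i" using i by auto
    then show ?thesis using that nth_in(2)[of "i - m"] W_eq(2)[of "i - m"] by simp
  qed
  then show ?thesis using code_Par[of x] code_Sig[of x] by auto
qed

sublocale pstring W K m .

text \<open>The coding is injective on parameters, and the codes below \<open>K\<close> are exactly
  theirs, so counting codes counts parameters.\<close>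

lemma length_firsts_params: "length (firsts m) = card (params Par P)"
proof -
  have "W ` {..<m} = code ` set P"
    using W_eq(1) by (fastforce simp: in_set_conv_nth image_iff)
  moreover have "code ` set P \<inter> {..<K} = code ` params Par P"
    using P code_less_iff by (fastforce simp: params_def)
  moreover have "inj_on code (params Par P)"
    using letter_coding unfolding letter_coding_def bij_betw_def params_def
    by (auto intro: inj_on_subset)
  ultimately show ?thesis by (simp add: length_firsts card_image)
qed

text \<open>P-matching depends only on which letters are parameters and which letters are equal, and
  the coding preserves both. Text position \<open>i\<close> is position \<open>m + i\<close> of
  \<open>W\<close>.\<close>

lemma p_occurrences_eq: "p_occurrences Par T P = {i. m + i \<le> n \<and> eqv 0 (m + i) m}"
proof -
  have "p_match Par (substring T i (i + m)) P \<longleftrightarrow> eqv 0 (m + i) m" if i: "m + i \<le> n" for i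
  proof -
    define x where "x = substring T i (i + m)"
    have x: "length x = m" "\<And>a. a < m \<Longrightarrow> x ! a = T ! (i + a)"
      using i by (auto simp: x_def substring_def)
    have in_alphabet: "x ! a \<in> Sig \<union> Par" "P ! a \<in> Sig \<union> Par" if "a < m" for a
      using nth_in(2)[of "i + a"] nth_in(1) x(2)[OF that] that i by auto
    have Wx: "W (m + i + a) = code (x ! a)" if "a < m" for a
      using W_eq(2)[of "i + a"] x(2)[OF that] that i by (simp add: add.assoc)
    note C = code_less_iff[OF in_alphabet(1)] code_less_iff[OF in_alphabet(2)]
      code_eq_iff[OF in_alphabet(1,1)] code_eq_iff[OF in_alphabet(1,2)] code_eq_iff[OF in_alphabet(2,2)]
    have "eqv (m + i) 0 m \<longleftrightarrow> p_match Par x P"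
      unfolding eqv_iff p_match_iff[OF finite_alphabets(2) x(1)] add_0
      by (intro all_cong1 imp_cong refl) (simp add: Wx W_eq C)
    then show ?thesis using eqv_sym unfolding x_def by blast
  qed
  then show ?thesis unfolding p_occurrences_def by (auto simp: add.commute)
qed

lemma search_locale:
  assumes "m \<le> n"
  shows "search W K m (map code T) (map code P) (base ^ 4) (3 * K + 2 * nat \<lfloor>log 2 m\<rfloor> + 2) n"
proof
  have base: "3 \<le> base" "K + 2 \<le> base" using assms m_pos K_pos by linarith+
  note pow = fourth_power_bounds[OF base(1)]
  have "W i < 3 * base + 4" if "i < n + m" for i using W_less[OF that] by simp
  then show "W i < base ^ 4" if "i < n + m" for i using pow(1) that less_trans by blast
  have "3 * K + 2 * m + 4 \<le> 3 * base + 4" by simp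
  then show "3 * K + 2 * m + 4 < base ^ 4" using pow(1) by (rule le_less_trans)
  have "k * (n + m + 1) \<le> 2 * base * base"
  proof (rule mult_le_mono)
    show "k \<le> 2 * base" using length_firsts_le[of m] base by (simp add: k_def)
    show "n + m + 1 \<le> base" using K_pos by simp
  qed
  then show "k * (n + m + 1) < base ^ 4" using pow(2) by (rule le_less_trans)
  show "3 * K + 2 * l + 2 \<le> 3 * K + 2 * nat \<lfloor>log 2 m\<rfloor> + 2" if "2 ^ l \<le> m" for l
  proof -
    have "2 ^ l \<le> real m" using that by (metis of_nat_le_iff of_nat_numeral of_nat_power)
    then have "real l \<le> log 2 m" by (rule le_log_of_power) simp
    then have "l \<le> nat \<lfloor>log 2 m\<rfloor>" by (rule le_nat_floor)
    then show ?thesis by simp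
  qed
qed (use assms m_pos K_pos W_eq in simp_all)

lemma p_search_correct:
  "\<exists>t s. finds_p_occurrences p_search Par code T P (base ^ 4) t s \<and>
    t \<le> 2000 * (card (params Par P) * n + m) \<and>
    real s \<le> real (card (regs p_search) + 7) * (log 2 (real m) + real K)"
proof -
  define R where "R = card (regs p_search)"
  have "1 \<le> real m" using m_pos by simp
  then have log: "0 \<le> log 2 (real m)" by (subst zero_le_log_cancel_iff) auto
  \<comment> \<open>Since \<open>K \<ge> 1\<close>, multiples of \<open>K\<close> absorb the number
    of registers; \<open>5 K\<close> stands for the fixed part \<open>3 K + 2\<close> of the
    memory.\<close>
  have Rlog: "real R + 5 * real K + 2 * log 2 (real m) \<le> real (R + 7) * (log 2 (real m) + real K)"
  proof -
    have "real R * 1 \<le> real R * (log 2 (real m) + real K)"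
      using log K_pos by (intro mult_left_mono) auto
    moreover have "5 * real K + 2 * log 2 (real m) \<le> 7 * (log 2 (real m) + real K)"
      using log by simp
    ultimately show ?thesis by (simp add: distrib_right)
  qed
  show ?thesis
  proof (cases "m \<le> n")
    case False
    \<comment> \<open>If the pattern is longer than the text, the program stops after the first
      test.\<close>
    have "exec (map code T) (map code P) (base ^ 4) 0 p_search (init_state n m K) (1 + 1) (init_state n m K)"
      unfolding p_search_def
      by (rule exec.IfTrue[OF _ exec.Skip]) (use False in \<open>simp add: init_state_def\<close>)
    moreover have "p_occurrences Par T P = {}" using False by (auto simp: p_occurrences_def)
    ultimately have "finds_p_occurrences p_search Par code T P (base ^ 4) 2 R"
      unfolding finds_p_occurrences_def R_def
      by (rule_tac exI[of _ "init_state n m K"], rule_tac exI[of _ "1 + 1"], rule_tac exI[of _ 0])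
        (simp add: init_state_def)
    moreover have "2 \<le> 2000 * (card (params Par P) * n + m)" using m_pos by simp
    moreover have "real R \<le> real (R + 7) * (log 2 (real m) + real K)" using Rlog log by simp
    ultimately show ?thesis unfolding R_def by blast
  next
    case True
    define s where "s = 3 * K + 2 * nat \<lfloor>log 2 m\<rfloor> + 2"
    interpret search W K m "map code T" "map code P" "base ^ 4" s n
      unfolding s_def by (rule search_locale[OF True])
    define t where "t = 240 * m + 200 * (k * (n + m)) + 60"
    have "wp p_search (\<lambda>st' t'. distinct (out st') \<and>
        set (out st') = p_occurrences Par T P \<and> 0 \<le> t') (init_state n m K) (int t)"
      unfolding p_occurrences_eq by (rule wp_p_search) (simp add: t_def)
    then have "finds_p_occurrences p_search Par code T P (base ^ 4) t (R + s)"
      unfolding wp_def finds_p_occurrences_def R_def by fastforce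
    moreover have "t \<le> 2000 * (card (params Par P) * n + m)"
    proof -
      define \<kappa>' where "\<kappa>' = card (params Par P)"
      have "1 \<le> \<kappa>'" using params by (simp add: \<kappa>'_def params_def Suc_le_eq card_gt_0_iff)
      \<comment> \<open>As \<open>\<kappa>' \<ge> 1\<close>,
        \<open>\<kappa>' + 4 \<le> 5 \<kappa>'\<close>; with \<open>m \<le> n\<close> this gives
        \<open>k (n + m) \<le> 10 \<kappa>' n\<close>, and the factor 200 in \<open>t\<close> turns
        this into 2000.\<close>
      then have "k \<le> 5 * \<kappa>'" by (simp add: k_def length_firsts_params \<kappa>'_def)
      then have "k * (n + m) \<le> (5 * \<kappa>') * (2 * n)" using True by (intro mult_le_mono) auto
      then have "X \<le> 10 * (\<kappa>' * n)" if "X = k * (n + m)" for X using that by simp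
      then show ?thesis using m_pos unfolding t_def \<kappa>'_def[symmetric] add_mult_distrib2[of 2000]
        by fastforce
    qed
    moreover have "real (R + s) \<le> real (R + 7) * (log 2 (real m) + real K)"
    proof -
      have "real (nat \<lfloor>log 2 m\<rfloor>) \<le> log 2 (real m)" using log by (rule of_nat_floor)
      then have "real (R + s) \<le> real R + 5 * real K + 2 * log 2 (real m)"
        using K_pos by (simp add: s_def)
      then show ?thesis using Rlog by simp
    qed
    ultimately show ?thesis unfolding R_def by blast
  qed
qed

end

theorem theorem2:
  shows "\<exists>(prog :: com) (e :: nat) (Ct :: nat) (Cs :: nat).
    \<forall>(Sig :: 'a set) (Par :: 'a set) (code :: 'a \<Rightarrow> nat) (T :: 'a list) (P :: 'a list).
      finite Sig \<and> finite Par \<and> Sig \<inter> Par = {} \<and> letter_coding Sig Par code \<and>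
      T \<in> lists (Sig \<union> Par) \<and> P \<in> lists (Sig \<union> Par) \<and> params Par P \<noteq> {} \<longrightarrow>
      (\<exists>t s :: nat.
        finds_p_occurrences prog Par code T P
          ((length T + length P + card Sig + card Par) ^ e) t s \<and>
        t \<le> Ct * (card (params Par P) * length T + length P) \<and>
        real s \<le> real Cs * (log 2 (real (length P)) + real (card Par)))"
proof (rule exI[of _ p_search], rule exI[of _ 4], rule exI[of _ 2000],
    rule exI[of _ "card (regs p_search) + 7"], intro allI impI)
  fix Sig Par :: "'a set" and code :: "'a \<Rightarrow> nat" and T P :: "'a list"
  assume "finite Sig \<and> finite Par \<and> Sig \<inter> Par = {} \<and> letter_coding Sig Par code \<and>
      T \<in> lists (Sig \<union> Par) \<and> P \<in> lists (Sig \<union> Par) \<and> params Par P \<noteq> {}"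
  then interpret coding Sig Par code T P by unfold_locales auto
  show "\<exists>t s :: nat.
        finds_p_occurrences p_search Par code T P
          ((length T + length P + card Sig + card Par) ^ 4) t s \<and>
        t \<le> 2000 * (card (params Par P) * length T + length P) \<and>
        real s \<le> real (card (regs p_search) + 7) * (log 2 (real (length P)) + real (card Par))"
    by (rule p_search_correct)
qed

end
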